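(* Let $f:\mathbb{R}^{n+m}\to\mathbb{R}$ be a $C^2$ function such that $\nabla f$ is globally Lipschitz with constant $L>0$ and $\nabla^2 f(z^\ast)$ is invertible at every saddle point $z^\ast$ of $f$. (i) For $\phi>L$ consider the ODE $\dot z=-(\nabla F(z)+\phi I)^{-1}F(z)$. There exists $\phi_{\min}$ such that for $\phi>\phi_{\min}$ (and $\phi>L$) the set of saddle points of $f$ is a subset of the set of exponentially stable equilibria of this ODE. (ii) Let $\phi>L$, let $f$ be moreover $C^3$ (so that $\nabla^2F$ below is defined), and for $s>0$ consider the ODE $$\dot z=\Big(-I-\tfrac{s}{2}\big((\nabla F(z)+\phi I)^{-1}\nabla F(z)-(\nabla F(z)+\phi I)^{-1}\nabla^2F(z)(\nabla F(z)+\phi I)^{-1}F(z)\big)\Big)(\nabla F(z)+\phi I)^{-1}F(z).$$ There exists $s_{\max}>0$ such that for $s\in(0,s_{\max})$ the set of saddle points of $f$ is a subset of the set of exponentially stable equilibria of this ODE.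
   Context: Write $z=(x,y)\in\mathbb{R}^n\times\mathbb{R}^m$. A (local) saddle point of $f$ is a point $(x^\ast,y^\ast)$ having a neighbourhood $U$ such that $f(x^\ast,y)\le f(x^\ast,y^\ast)\le f(x,y^\ast)$ for all $(x,y)\in U$. Notation: $F(z)=\begin{bmatrix}\nabla_x f(z)\\-\nabla_y f(z)\end{bmatrix}$; $\nabla F$ is the Jacobian matrix of $F$; $\nabla^2F(z)$ is the second derivative (a symmetric bilinear map), and for a vector $u$ and a matrix $A$ the expression $A\nabla^2F(z)u$ denotes the matrix $v\mapsto A\,\nabla^2F(z)[v,u]$ (above $A=(\nabla F(z)+\phi I)^{-1}$ and $u=(\nabla F(z)+\phi I)^{-1}F(z)$). For $\phi>L$ the matrix $\nabla F(z)+\phi I$ is invertible for all $z$. An equilibrium $Z^e$ of an ODE is exponentially stable (meant locally) if it is stable (for every $\varepsilon>0$ there is $\delta>0$ such that $|Z(0)-Z^e|<\delta$ implies $|Z(t)-Z^e|<\varepsilon$ for all $t\ge0$) and there exist $\delta,M,\lambda>0$ such that $|Z(0)-Z^e|<\delta$ implies $|Z(t)-Z^e|\le Me^{-\lambda t}|Z(0)-Z^e|$ for all $t\ge0$. (The ODEs in (i) and (ii) are the $O(1)$- and $O(s)$-resolution ODEs of the Regularised Damped Newton iteration $z_{k+1}=z_k-s(\nabla F(z_k)+\phi I)^{-1}F(z_k)$.) *)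

theory Defs
  imports "HOL-Analysis.Analysis"
begin

subsection \<open>Differentiability\<close>

text \<open>Class $C^k$ on the whole space. On a finite-dimensional domain, continuity of all
  iterated directional derivatives is continuity of the iterated Frechet derivatives.\<close>

primrec C_k :: "nat \<Rightarrow> ('a::euclidean_space \<Rightarrow> 'b::real_normed_vector) \<Rightarrow> bool" where
  "C_k 0 f \<longleftrightarrow> continuous_on UNIV f"
| "C_k (Suc k) f \<longleftrightarrow> (\<forall>z. f differentiable (at z)) \<and>
     (\<forall>v. C_k k (\<lambda>z. frechet_derivative f (at z) v))"

definition gradient :: "('a::euclidean_space \<Rightarrow> real) \<Rightarrow> 'a \<Rightarrow> 'a" where
  "gradient f z = (THE g. GDERIV f z :> g)"

text \<open>Matrices (Hessian, Jacobian) are represented by the linear maps they define.\<close>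

definition jacobian_map :: "('a::euclidean_space \<Rightarrow> 'a) \<Rightarrow> 'a \<Rightarrow> 'a \<Rightarrow> 'a" where
  "jacobian_map F z = frechet_derivative F (at z)"

definition hessian_map :: "('a::euclidean_space \<Rightarrow> real) \<Rightarrow> 'a \<Rightarrow> 'a \<Rightarrow> 'a" where
  "hessian_map f z = jacobian_map (gradient f) z"

definition second_derivative :: "('a::euclidean_space \<Rightarrow> 'a) \<Rightarrow> 'a \<Rightarrow> 'a \<Rightarrow> 'a \<Rightarrow> 'a" where
  "second_derivative F z v u = frechet_derivative (\<lambda>w. jacobian_map F w u) (at z) v"


subsection \<open>Saddle points\<close>

definition saddle_point ::
    "('a::euclidean_space \<times> 'b::euclidean_space \<Rightarrow> real) \<Rightarrow> 'a \<times> 'b \<Rightarrow> bool" where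
  "saddle_point f z \<longleftrightarrow> (\<exists>U. open U \<and> z \<in> U \<and>
     (\<forall>(x, y) \<in> U. f (fst z, y) \<le> f z \<and> f z \<le> f (x, snd z)))"

definition saddle_field ::
    "('a::euclidean_space \<times> 'b::euclidean_space \<Rightarrow> real) \<Rightarrow> 'a \<times> 'b \<Rightarrow> 'a \<times> 'b" where
  "saddle_field f z =
     (gradient (\<lambda>x. f (x, snd z)) (fst z), - gradient (\<lambda>y. f (fst z, y)) (snd z))"


subsection \<open>The resolution ODEs of Regularised Damped Newton\<close>

text \<open>\<open>reg_inverse F \<phi> z\<close> is $(\nabla F(z)+\phi I)^{-1}$. It is the genuine inverse only if that
  map is bijective, which is the case for $\phi$ above the Lipschitz constant of $F$.\<close>

definition reg_inverse :: "('a::euclidean_space \<Rightarrow> 'a) \<Rightarrow> real \<Rightarrow> 'a \<Rightarrow> 'a \<Rightarrow> 'a" where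
  "reg_inverse F \<phi> z = inv (\<lambda>v. jacobian_map F z v + \<phi> *\<^sub>R v)"

definition rdn_ode_O1 :: "('a::euclidean_space \<Rightarrow> 'a) \<Rightarrow> real \<Rightarrow> 'a \<Rightarrow> 'a" where
  "rdn_ode_O1 F \<phi> z = - reg_inverse F \<phi> z (F z)"

definition rdn_ode_Os :: "('a::euclidean_space \<Rightarrow> 'a) \<Rightarrow> real \<Rightarrow> real \<Rightarrow> 'a \<Rightarrow> 'a" where
  "rdn_ode_Os F \<phi> s z =
     (let A = reg_inverse F \<phi> z;
          u = A (F z)
      in (\<lambda>v. - v - (s / 2) *\<^sub>R (A (jacobian_map F z v) - A (second_derivative F z v u))) u)"


subsection \<open>Exponential stability\<close>

definition ode_solution :: "('a::euclidean_space \<Rightarrow> 'a) \<Rightarrow> real set \<Rightarrow> 'a \<Rightarrow> (real \<Rightarrow> 'a) \<Rightarrow> bool" where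
  "ode_solution g I z\<^sub>0 Z \<longleftrightarrow>
     Z 0 = z\<^sub>0 \<and> (\<forall>t\<in>I. (Z has_vector_derivative g (Z t)) (at t within I))"

definition equilibrium :: "('a::euclidean_space \<Rightarrow> 'a) \<Rightarrow> 'a \<Rightarrow> bool" where
  "equilibrium g z\<^sub>e \<longleftrightarrow> g z\<^sub>e = 0"

text \<open>The right-hand sides above are in general merely continuous, so solutions need not be unique.
  Bounds ``for all \<open>t \<ge> 0\<close>'' are therefore required of every solution
  on every interval \<open>[0,T)\<close>, which covers solutions on \<open>[0,\<infinity>)\<close> by restriction and excludes blow-up.
  That solutions exist for all \<open>t \<ge> 0\<close>, which the usual wording presupposes,
  is demanded separately, so that the bounds are not vacuous.\<close>

definition locally_global_solutions :: "('a::euclidean_space \<Rightarrow> 'a) \<Rightarrow> 'a \<Rightarrow> bool" where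
  "locally_global_solutions g z\<^sub>e \<longleftrightarrow>
     (\<exists>\<delta>>0. \<forall>z\<^sub>0. norm (z\<^sub>0 - z\<^sub>e) < \<delta> \<longrightarrow> (\<exists>Z. ode_solution g {0..} z\<^sub>0 Z))"

definition stable :: "('a::euclidean_space \<Rightarrow> 'a) \<Rightarrow> 'a \<Rightarrow> bool" where
  "stable g z\<^sub>e \<longleftrightarrow>
     (\<forall>\<epsilon>>0. \<exists>\<delta>>0. \<forall>T>0. \<forall>z\<^sub>0 Z. ode_solution g {0..<T} z\<^sub>0 Z \<and> norm (z\<^sub>0 - z\<^sub>e) < \<delta> \<longrightarrow>
        (\<forall>t\<in>{0..<T}. norm (Z t - z\<^sub>e) < \<epsilon>))"

definition exponentially_attracting :: "('a::euclidean_space \<Rightarrow> 'a) \<Rightarrow> 'a \<Rightarrow> bool" where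
  "exponentially_attracting g z\<^sub>e \<longleftrightarrow>
     (\<exists>\<delta>>0. \<exists>M>0. \<exists>r>0. \<forall>T>0. \<forall>z\<^sub>0 Z.
        ode_solution g {0..<T} z\<^sub>0 Z \<and> norm (z\<^sub>0 - z\<^sub>e) < \<delta> \<longrightarrow>
        (\<forall>t\<in>{0..<T}. norm (Z t - z\<^sub>e) \<le> M * exp (- r * t) * norm (z\<^sub>0 - z\<^sub>e)))"

definition exponentially_stable_equilibrium :: "('a::euclidean_space \<Rightarrow> 'a) \<Rightarrow> 'a \<Rightarrow> bool" where
  "exponentially_stable_equilibrium g z\<^sub>e \<longleftrightarrow>
     equilibrium g z\<^sub>e \<and> locally_global_solutions g z\<^sub>e \<and> stable g z\<^sub>e \<and> exponentially_attracting g z\<^sub>e"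

end

theory Submission
  imports Defs "HOL-Complex_Analysis.Great_Picard"
begin

text \<open>
  At a saddle point the Jacobian \<open>J\<close> of \<open>F\<close> satisfies \<open>J w \<bullet> w \<ge> 0\<close>: the mixed second derivatives
  cancel and the diagonal blocks are semidefinite. With \<open>P = (J + \<phi>I)\<inverse> J\<close> and \<open>v = (J + \<phi>I) w\<close>, so that
  \<open>P v = J w\<close>, this yields \<open>v \<bullet> P v \<ge> |P v|\<^sup>2\<close>, and the same inequality for the adjoint of \<open>P\<close>. Hence
  \<open>v \<bullet> P v \<ge> c|v|\<^sup>2\<close> for some \<open>c > 0\<close>, because \<open>P\<close> is invertible, and \<open>v \<bullet> P (P v) \<ge> - (v \<bullet> P v)\<close>. The two
  right-hand sides are differentiable at the saddle point with derivatives \<open>- P\<close> and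
  \<open>- P - (s/2) P P\<close>, both negative definite when \<open>\<phi> > L\<close> and \<open>0 < s < 2\<close>. So the squared distance to the
  saddle point is a strict Lyapunov function. As the right-hand side of the \<open>O(s)\<close> equation is merely
  continuous, the existence of solutions rests on Peano's theorem.
\<close>

subsection \<open>Peano's theorem\<close>

text \<open>The constant \<open>M\<close> depends only on the bound for \<open>p\<close>, so every
  approximate solution built below is Lipschitz with the same constant.\<close>

lemma lipschitz_on_indefinite_integral:
  fixes p :: "real \<Rightarrow> 'a::euclidean_space"
  assumes cont: "continuous_on UNIV p" and bound: "\<And>s. norm (p s) \<le> M"
  shows "M-lipschitz_on UNIV (\<lambda>t. c + integral {0..t} p)"
proof (rule lipschitz_onI)
  show M: "0 \<le> M"
    using bound[of 0] norm_ge_zero order_trans by blast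
  have le: "norm (integral {0..t'} p - integral {0..t} p) \<le> M * (t' - t)" if "t \<le> t'" for t t'
  proof -
    have ib: "norm (integral {a..b} p) \<le> M * (b - a)" if "a \<le> b" for a b
      using that bound by (intro integral_bound continuous_on_subset[OF cont]) auto
    \<comment> \<open>For negative \<open>t\<close> the interval \<open>{0..t}\<close> is empty, so
      the integral is 0 there and the function is constant to the left of 0.\<close>
    consider "t' < 0" | "t < 0" "0 \<le> t'" | "0 \<le> t" by linarith
    then show ?thesis
    proof cases
      case 1
      then show ?thesis using that M by simp
    next
      case 2
      have "norm (integral {0..t'} p) \<le> M * (t' - 0)" using ib 2 by blast
      also have "\<dots> \<le> M * (t' - t)" using M 2 by (intro mult_left_mono) auto
      finally show ?thesis using 2 by simp
    next
      case 3
      have "integral {0..t} p + integral {t..t'} p = integral {0..t'} p"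
        using 3 that by (intro Henstock_Kurzweil_Integration.integral_combine integrable_continuous_real continuous_on_subset[OF cont]) auto
      then have "integral {0..t'} p - integral {0..t} p = integral {t..t'} p"
        by (simp add: algebra_simps)
      then show ?thesis using ib that by simp
    qed
  qed
  fix x y :: real
  show "dist (c + integral {0..x} p) (c + integral {0..y} p) \<le> M * dist x y"
    using le[of x y] le[of y x] by (cases "x \<le> y") (auto simp: dist_norm norm_minus_commute)
qed

text \<open>The method of steps: with a delay \<open>h\<close>, the right-hand side at time
  \<open>t\<close> sees \<open>Y\<close> only up to \<open>t - h\<close>. The Picard iterates
  therefore stop changing on \<open>{..k * h}\<close> after \<open>k\<close> rounds, and finitely
  many rounds settle everything up to \<open>T\<close>.\<close>

lemma delayed_integral_equation:
  fixes g :: "'a::euclidean_space \<Rightarrow> 'a" and h :: real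
  assumes cont: "continuous_on UNIV g" and bound: "\<And>x. norm (g x) \<le> M" and h: "0 < h"
  obtains Y where "M-lipschitz_on UNIV Y"
    and "\<And>t. t \<le> T \<Longrightarrow> Y t = x\<^sub>0 + integral {0..t} (\<lambda>s. g (Y (s - h)))"
proof -
  define \<Phi> where "\<Phi> Y t = x\<^sub>0 + integral {0..t} (\<lambda>s. g (Y (s - h)))" for Y :: "real \<Rightarrow> 'a" and t
  define W where "W k = (\<Phi> ^^ k) (\<lambda>_. x\<^sub>0)" for k
  have W_Suc: "W (Suc k) = \<Phi> (W k)" for k
    by (simp add: W_def)
  have M: "0 \<le> M"
    using bound[of 0] norm_ge_zero order_trans by blast
  have lip: "M-lipschitz_on UNIV (W k)" for k
  proof (induction k)
    case 0
    then show ?case using M by (simp add: W_def lipschitz_on_def)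
  next
    case (Suc k)
    have "continuous_on UNIV (\<lambda>s. g (W k (s - h)))"
      by (intro continuous_intros continuous_on_compose2[OF cont]
            continuous_on_compose2[OF lipschitz_on_continuous_on[OF Suc]]) auto
    then have "M-lipschitz_on UNIV (\<lambda>t. x\<^sub>0 + integral {0..t} (\<lambda>s. g (W k (s - h))))"
      by (rule lipschitz_on_indefinite_integral) (rule bound)
    then show ?case
      by (simp add: W_Suc \<Phi>_def[abs_def])
  qed
  \<comment> \<open>Each round extends the settled range by \<open>h\<close>. The base case is the
    range \<open>t \<le> 0\<close>, where the integral vanishes.\<close>
  have stab: "W (Suc k) t = W k t" if "t \<le> real k * h" for k t
    using that
  proof (induction k arbitrary: t)
    case 0
    then have "{0..t} = {} \<or> {0..t} = {0}" by auto
    then show ?case by (auto simp: W_def \<Phi>_def)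
  next
    case (Suc k)
    have "W (Suc k) (s - h) = W k (s - h)" if "s \<in> {0..t}" for s
      using that Suc.prems by (intro Suc.IH) (auto simp: algebra_simps)
    then have "integral {0..t} (\<lambda>s. g (W (Suc k) (s - h))) = integral {0..t} (\<lambda>s. g (W k (s - h)))"
      by (intro integral_cong) auto
    then show ?case
      by (simp add: W_Suc[of "Suc k"] W_Suc[of k] \<Phi>_def)
  qed
  obtain k :: nat where k: "T / h < real k"
    using reals_Archimedean2 by blast
  have "W k t = x\<^sub>0 + integral {0..t} (\<lambda>s. g (W k (s - h)))" if "t \<le> T" for t
  proof -
    have "t \<le> real k * h" using k h that by (simp add: field_simps)
    from stab[OF this] show ?thesis by (simp add: W_Suc \<Phi>_def)
  qed
  with lip show ?thesis using that by blast
qed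

text \<open>Tonelli's variant of Peano's theorem: solutions of the equation with the time delay
  \<open>1/n\<close> are equi-Lipschitz, and a subsequence converges to a solution of the ODE.\<close>

theorem peano_bounded:
  fixes g :: "'a::euclidean_space \<Rightarrow> 'a"
  assumes cont: "continuous_on UNIV g" and bound: "\<And>x. norm (g x) \<le> M"
  shows "\<exists>Z. ode_solution g {0..} x\<^sub>0 Z"
proof -
  define h where "h n = 1 / real (Suc n)" for n
  have h_pos: "0 < h n" for n by (simp add: h_def)
  have h_0: "h \<longlonglongrightarrow> 0"
    unfolding h_def using LIMSEQ_inverse_real_of_nat by (simp add: inverse_eq_divide)
  have M: "0 \<le> M"
    using bound[of 0] norm_ge_zero order_trans by blast
  have "\<forall>n. \<exists>Y. M-lipschitz_on UNIV Y \<and>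
      (\<forall>t\<le>real n. Y t = x\<^sub>0 + integral {0..t} (\<lambda>s. g (Y (s - h n))))"
    using delayed_integral_equation[OF cont bound h_pos] by metis
  then obtain Y where lip: "\<And>n. M-lipschitz_on UNIV (Y n)"
    and Y: "\<And>n t. t \<le> real n \<Longrightarrow> Y n t = x\<^sub>0 + integral {0..t} (\<lambda>s. g (Y n (s - h n)))"
    by metis
  have Y0: "Y n 0 = x\<^sub>0" for n
    using Y[of 0 n] by simp
  have growth: "norm (Y n t) \<le> norm x\<^sub>0 + M * \<bar>t\<bar>" for n t
    using lipschitz_onD[OF lip, of t 0 n] norm_triangle_sub[of "Y n t" x\<^sub>0]
    by (simp add: Y0 dist_norm)
  \<comment> \<open>The approximations grow at most linearly in time. Dividing by
    \<open>1 + \<bar>t\<bar>\<close> gives a bound uniform in \<open>t\<close> as well, as the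
    diagonal extraction over the rationals requires.\<close>
  have sc_bound: "norm (Y n t /\<^sub>R (1 + \<bar>t\<bar>)) \<le> norm x\<^sub>0 + M" if "t \<in> \<rat>" for n t
  proof -
    have "norm x\<^sub>0 + M * \<bar>t\<bar> \<le> (norm x\<^sub>0 + M) * (1 + \<bar>t\<bar>)"
      using M by (simp add: algebra_simps)
    then have "norm (Y n t) / (1 + \<bar>t\<bar>) \<le> norm x\<^sub>0 + M"
      using growth[of n t] by (subst pos_divide_le_eq) auto
    then show ?thesis
      by (simp add: divide_inverse mult.commute)
  qed
  obtain k :: "nat \<Rightarrow> nat" where k: "strict_mono k"
    and conv: "\<And>t. t \<in> \<rat> \<Longrightarrow> \<exists>l. (\<lambda>n. Y (k n) t /\<^sub>R (1 + \<bar>t\<bar>)) \<longlonglongrightarrow> l"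
    using function_convergent_subsequence[of "\<rat>" "\<lambda>n t. Y n t /\<^sub>R (1 + \<bar>t\<bar>)" "norm x\<^sub>0 + M"]
      countable_rat sc_bound by metis
  have conv_rat: "convergent (\<lambda>n. Y (k n) t)" if t: "t \<in> \<rat>" for t
  proof -
    obtain l where "(\<lambda>n. Y (k n) t /\<^sub>R (1 + \<bar>t\<bar>)) \<longlonglongrightarrow> l" using conv[OF t] by blast
    then have "(\<lambda>n. (1 + \<bar>t\<bar>) *\<^sub>R (Y (k n) t /\<^sub>R (1 + \<bar>t\<bar>))) \<longlonglongrightarrow> (1 + \<bar>t\<bar>) *\<^sub>R l"
      by (intro tendsto_intros)
    moreover have "1 + \<bar>t\<bar> \<noteq> 0" by linarith
    ultimately show ?thesis
      by (auto simp: convergent_def)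
  qed
  \<comment> \<open>The common Lipschitz constant carries convergence from a rational
    \<open>q\<close> near \<open>t\<close> to \<open>t\<close>, at a cost of \<open>e / 3\<close>
    for each of three terms. The \<open>M + 1\<close> in \<open>d\<close> guards against
    \<open>M = 0\<close>.\<close>
  have "convergent (\<lambda>n. Y (k n) t)" for t
  proof (rule Cauchy_convergent, rule CauchyI)
    fix e :: real assume e: "0 < e"
    define d where "d = e / (3 * (M + 1))"
    have d: "0 < d" "M * d \<le> e / 3"
      using e M by (auto simp: d_def field_simps)
    obtain q where q: "q \<in> \<rat>" "t - d < q" "q < t"
      using Rats_dense_in_real[of "t - d" t] d by auto
    have "Cauchy (\<lambda>n. Y (k n) q)"
      using conv_rat[OF q(1)] convergent_Cauchy by blast
    then obtain N where N: "\<And>m n. N \<le> m \<Longrightarrow> N \<le> n \<Longrightarrow> norm (Y (k m) q - Y (k n) q) < e / 3"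
      using CauchyD[of _ "e / 3"] e by (metis divide_pos_pos zero_less_numeral)
    have near: "norm (Y n t - Y n q) \<le> e / 3" for n
    proof -
      have "norm (Y n t - Y n q) \<le> M * \<bar>t - q\<bar>"
        using lipschitz_onD[OF lip, of t q n] by (simp add: dist_norm)
      also have "\<dots> \<le> M * d" using q M by (intro mult_left_mono) auto
      finally show ?thesis using d by linarith
    qed
    show "\<exists>N. \<forall>m\<ge>N. \<forall>n\<ge>N. norm (Y (k m) t - Y (k n) t) < e"
    proof (intro exI allI impI)
      fix m n assume "N \<le> m" "N \<le> n"
      have "norm (Y (k m) t - Y (k n) t)
          \<le> norm (Y (k m) t - Y (k m) q) + norm (Y (k m) q - Y (k n) q) + norm (Y (k n) q - Y (k n) t)"
        by norm
      then show "norm (Y (k m) t - Y (k n) t) < e"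
        using near[of "k m"] near[of "k n"] N[OF \<open>N \<le> m\<close> \<open>N \<le> n\<close>]
        by (simp add: norm_minus_commute)
    qed
  qed
  then obtain Z where Z: "\<And>t. (\<lambda>n. Y (k n) t) \<longlonglongrightarrow> Z t"
    unfolding convergent_def by metis
  have hk: "(\<lambda>n. h (k n)) \<longlonglongrightarrow> 0"
    using LIMSEQ_subseq_LIMSEQ[OF h_0 k] by (simp add: o_def)
  have contg: "isCont g x" for x
    using cont by (simp add: continuous_on_eq_continuous_at)
  \<comment> \<open>A delay of \<open>h (k n)\<close> moves the approximation by at most
    \<open>M * h (k n)\<close>, which tends to 0.\<close>
  have delayed: "(\<lambda>n. g (Y (k n) (s - h (k n)))) \<longlonglongrightarrow> g (Z s)" for s
  proof -
    have "(\<lambda>n. Y (k n) (s - h (k n)) - Y (k n) s) \<longlonglongrightarrow> 0"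
    proof (rule tendsto_norm_zero_cancel, rule tendsto_sandwich[where f = "\<lambda>_. 0"])
      show "\<forall>\<^sub>F n in sequentially. norm (Y (k n) (s - h (k n)) - Y (k n) s) \<le> M * h (k n)"
      proof (intro always_eventually allI)
        fix n
        show "norm (Y (k n) (s - h (k n)) - Y (k n) s) \<le> M * h (k n)"
          using lipschitz_onD[OF lip, of "s - h (k n)" s "k n"] h_pos[of "k n"]
          by (simp add: dist_norm)
      qed
      show "(\<lambda>n. M * h (k n)) \<longlonglongrightarrow> 0"
        using tendsto_mult[OF tendsto_const hk, of M] by simp
    qed auto
    from tendsto_add[OF this Z[of s]] have "(\<lambda>n. Y (k n) (s - h (k n))) \<longlonglongrightarrow> Z s"
      by simp
    then show ?thesis
      using contg isCont_tendsto_compose by blast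
  qed
  have lipZ: "M-lipschitz_on UNIV Z"
  proof (rule lipschitz_onI)
    fix x y
    have "(\<lambda>n. dist (Y (k n) x) (Y (k n) y)) \<longlonglongrightarrow> dist (Z x) (Z y)"
      by (intro tendsto_intros Z)
    then show "dist (Z x) (Z y) \<le> M * dist x y"
      using lipschitz_onD[OF lip] by (intro LIMSEQ_le_const2) auto
  qed (fact M)
  have int_eq: "Z t = x\<^sub>0 + integral {0..t} (\<lambda>s. g (Z s))" for t
  proof -
    have "(\<lambda>n. integral {0..t} (\<lambda>s. g (Y (k n) (s - h (k n))))) \<longlonglongrightarrow> integral {0..t} (\<lambda>s. g (Z s))"
    proof (rule dominated_convergence(2)[where h = "\<lambda>_. M"])
      show "(\<lambda>s. g (Y (k n) (s - h (k n)))) integrable_on {0..t}" for n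
        by (intro integrable_continuous_real continuous_intros continuous_on_compose2[OF cont]
            continuous_on_compose2[OF lipschitz_on_continuous_on[OF lip]]) auto
    qed (use bound delayed in auto)
    then have "(\<lambda>n. x\<^sub>0 + integral {0..t} (\<lambda>s. g (Y (k n) (s - h (k n)))))
        \<longlonglongrightarrow> x\<^sub>0 + integral {0..t} (\<lambda>s. g (Z s))"
      by (intro tendsto_intros)
    \<comment> \<open>The delayed equation of index \<open>k n\<close> is known only up to time
      \<open>k n\<close>; since \<open>k n \<ge> n\<close>, every fixed \<open>t\<close> is
      eventually covered.\<close>
    moreover have "\<forall>\<^sub>F n in sequentially.
        x\<^sub>0 + integral {0..t} (\<lambda>s. g (Y (k n) (s - h (k n)))) = Y (k n) t"
    proof -
      obtain N :: nat where N: "t \<le> real N" using real_arch_simple by blast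
      have "t \<le> real (k n)" if "N \<le> n" for n
        using N that seq_suble[OF k, of n] by linarith
      then show ?thesis
        using Y by (intro eventually_sequentiallyI[of N]) auto
    qed
    ultimately have "(\<lambda>n. Y (k n) t) \<longlonglongrightarrow> x\<^sub>0 + integral {0..t} (\<lambda>s. g (Z s))"
      using Lim_transform_eventually by fastforce
    then show ?thesis
      using Z LIMSEQ_unique by blast
  qed
  have "ode_solution g {0..} x\<^sub>0 Z"
    unfolding ode_solution_def
  proof (intro conjI ballI)
    show "Z 0 = x\<^sub>0" using int_eq[of 0] by simp
    fix t :: real assume t: "t \<in> {0..}"
    have "continuous_on {0..t+1} (\<lambda>s. g (Z s))"
      by (intro continuous_on_compose2[OF cont]
          continuous_on_subset[OF lipschitz_on_continuous_on[OF lipZ]]) auto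
    then have "((\<lambda>u. integral {0..u} (\<lambda>s. g (Z s))) has_vector_derivative g (Z t)) (at t within {0..t+1})"
      using t by (intro integral_has_vector_derivative) auto
    then have "((\<lambda>u. x\<^sub>0 + integral {0..u} (\<lambda>s. g (Z s))) has_vector_derivative g (Z t)) (at t within {0..t+1})"
      using has_vector_derivative_add[OF has_vector_derivative_const] by fastforce
    moreover have "(\<lambda>u. x\<^sub>0 + integral {0..u} (\<lambda>s. g (Z s))) = Z"
      by (rule ext) (rule int_eq[symmetric])
    moreover have "at t within {0..t+1} = at t within {0..}"
      by (rule at_within_nhd[where S = "{..<t+1}"]) auto
    ultimately show "(Z has_vector_derivative g (Z t)) (at t within {0..})"
      by simp
  qed
  then show ?thesis by blast
qed

subsection \<open>Exponential stability of dissipative equilibria\<close>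

text \<open>While the solution stays in the ball, \<open>V\<close>, the squared distance weighted by
  \<open>exp (2 * k * s)\<close>, cannot increase. A first-exit argument then shows that the
  solution never leaves the ball.\<close>

lemma dissipative_decay:
  fixes g :: "'a::euclidean_space \<Rightarrow> 'a"
  assumes diss: "\<And>x. norm (x - z\<^sub>e) < r \<Longrightarrow> (x - z\<^sub>e) \<bullet> g x \<le> - k * (norm (x - z\<^sub>e))\<^sup>2"
    and k: "0 \<le> k" and t: "0 \<le> t"
    and Z: "\<And>s. s \<in> {0..t} \<Longrightarrow> (Z has_vector_derivative g (Z s)) (at s within {0..t})"
    and start: "norm (Z 0 - z\<^sub>e) < r"
  shows "norm (Z t - z\<^sub>e) \<le> exp (- k * t) * norm (Z 0 - z\<^sub>e)"
proof -
  define V where "V s = exp (2 * k * s) * ((Z s - z\<^sub>e) \<bullet> (Z s - z\<^sub>e))" for s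
  have contZ: "continuous_on {0..t} Z"
    using Z by (meson continuous_on_eq_continuous_within has_vector_derivative_continuous)
  \<comment> \<open>Membership in the ball is demanded only on the open interval before
    \<open>t'\<close>, so that the estimate may be applied at the first exit time itself.\<close>
  have decay: "norm (Z t' - z\<^sub>e) \<le> exp (- k * t') * norm (Z 0 - z\<^sub>e)"
    if t': "0 \<le> t'" "t' \<le> t" and inside: "\<And>s. 0 < s \<Longrightarrow> s < t' \<Longrightarrow> norm (Z s - z\<^sub>e) < r" for t'
  proof -
    have "V t' \<le> V 0"
    proof (rule DERIV_nonpos_imp_decreasing_open[OF t'(1)])
      fix s assume s: "0 < s" "s < t'"
      then have "at s within {0..t} = at s"
        using t' by (intro at_within_interior) auto
      then have "(Z has_vector_derivative g (Z s)) (at s)"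
        using Z[of s] s t' by auto
      then have dZ: "(Z has_derivative (\<lambda>x. x *\<^sub>R g (Z s))) (at s)"
        by (simp add: has_vector_derivative_def)
      have "(V has_derivative (\<lambda>x. x * (2 * exp (2 * k * s) *
          (k * (norm (Z s - z\<^sub>e))\<^sup>2 + (Z s - z\<^sub>e) \<bullet> g (Z s))))) (at s)"
        unfolding V_def
        by (rule derivative_eq_intros dZ refl)+
          (auto simp: algebra_simps inner_commute power2_norm_eq_inner)
      then have "(V has_real_derivative (2 * exp (2 * k * s) *
          (k * (norm (Z s - z\<^sub>e))\<^sup>2 + (Z s - z\<^sub>e) \<bullet> g (Z s)))) (at s)"
        unfolding has_field_derivative_def by (rule has_derivative_eq_rhs) (simp add: fun_eq_iff)
      moreover have "2 * exp (2 * k * s) *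
          (k * (norm (Z s - z\<^sub>e))\<^sup>2 + (Z s - z\<^sub>e) \<bullet> g (Z s)) \<le> 0"
        using diss[OF inside[OF s]] by (intro mult_nonneg_nonpos) auto
      ultimately show "\<exists>y. (V has_real_derivative y) (at s) \<and> y \<le> 0" by blast
    next
      show "continuous_on {0..t'} V"
        unfolding V_def using t'
        by (intro continuous_intros continuous_on_subset[OF contZ]) auto
    qed
    then have "exp (2 * k * t') * (norm (Z t' - z\<^sub>e))\<^sup>2 \<le> (norm (Z 0 - z\<^sub>e))\<^sup>2"
      by (simp add: V_def power2_norm_eq_inner)
    moreover have "exp (2 * k * t') = (exp (k * t'))\<^sup>2"
      by (simp add: exp_double mult.assoc)
    ultimately have "(exp (k * t') * norm (Z t' - z\<^sub>e))\<^sup>2 \<le> (norm (Z 0 - z\<^sub>e))\<^sup>2"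
      by (simp add: power_mult_distrib)
    then have "exp (k * t') * norm (Z t' - z\<^sub>e) \<le> norm (Z 0 - z\<^sub>e)"
      by (rule power2_le_imp_le) simp
    then show ?thesis
      by (simp add: exp_minus field_simps)
  qed
  \<comment> \<open>The exit times form a compact set. At the least of them, \<open>decay\<close>
    bounds the distance by its initial value, which is below \<open>r\<close>.\<close>
  have "norm (Z s - z\<^sub>e) < r" if "s \<in> {0..t}" for s
  proof (rule ccontr)
    assume "\<not> norm (Z s - z\<^sub>e) < r"
    let ?A = "{0..t} \<inter> (\<lambda>s. norm (Z s - z\<^sub>e)) -` {r..}"
    have "closed ?A"
      by (intro continuous_closed_preimage closed_atLeast continuous_intros contZ)
    moreover have "bounded ?A"
      by (rule bounded_subset[OF bounded_closed_interval[of 0 t]]) auto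
    ultimately have "compact ?A" by (simp add: compact_eq_bounded_closed)
    moreover have "?A \<noteq> {}" using that \<open>\<not> _\<close> by auto
    ultimately obtain t1 where t1: "t1 \<in> ?A" "\<And>s. s \<in> ?A \<Longrightarrow> t1 \<le> s"
      using compact_attains_inf by metis
    have "norm (Z s - z\<^sub>e) < r" if "0 < s" "s < t1" for s
      using t1(1) t1(2)[of s] that by force
    then have "norm (Z t1 - z\<^sub>e) \<le> exp (- k * t1) * norm (Z 0 - z\<^sub>e)"
      using t1(1) by (intro decay) auto
    also have "\<dots> \<le> 1 * norm (Z 0 - z\<^sub>e)"
      using t1 k by (intro mult_right_mono) auto
    finally show False using t1 start by auto
  qed
  then show ?thesis using decay[of t] t by auto
qed

text \<open>Stability and attraction, the latter with \<open>M = 1\<close>, are direct from the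
  decay estimate. Existence of global solutions is the part that calls for Peano's theorem.\<close>

lemma exponentially_stable_if_dissipative:
  fixes g :: "'a::euclidean_space \<Rightarrow> 'a"
  assumes cont: "continuous_on UNIV g" and zero: "g z\<^sub>e = 0"
    and r: "0 < r" and k: "0 < k"
    and diss: "\<And>x. norm (x - z\<^sub>e) < r \<Longrightarrow> (x - z\<^sub>e) \<bullet> g x \<le> - k * (norm (x - z\<^sub>e))\<^sup>2"
  shows "exponentially_stable_equilibrium g z\<^sub>e"
proof -
  have decay: "norm (Z t - z\<^sub>e) \<le> exp (- k * t) * norm (z\<^sub>0 - z\<^sub>e)"
    if "ode_solution g {0..<T} z\<^sub>0 Z" "norm (z\<^sub>0 - z\<^sub>e) < r" "t \<in> {0..<T}" for T z\<^sub>0 Z t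
  proof -
    have "(Z has_vector_derivative g (Z s)) (at s within {0..t})" if "s \<in> {0..t}" for s
      using that \<open>ode_solution g {0..<T} z\<^sub>0 Z\<close> \<open>t \<in> {0..<T}\<close>
      by (auto simp: ode_solution_def intro: has_vector_derivative_within_subset[of Z _ _ "{0..<T}"])
    then have "norm (Z t - z\<^sub>e) \<le> exp (- k * t) * norm (Z 0 - z\<^sub>e)"
      using that k diss
      by (intro dissipative_decay[where g = g and r = r]) (auto simp: ode_solution_def)
    then show ?thesis
      using that by (simp add: ode_solution_def)
  qed
  have le: "exp (- k * t) * a \<le> a" if "0 \<le> t" "0 \<le> a" for t a :: real
    using that k by (intro mult_left_le_one_le) auto
  have "stable g z\<^sub>e"
    unfolding stable_def
  proof (intro allI impI)
    fix \<epsilon> :: real assume "0 < \<epsilon>"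
    show "\<exists>\<delta>>0. \<forall>T>0. \<forall>z\<^sub>0 Z. ode_solution g {0..<T} z\<^sub>0 Z \<and> norm (z\<^sub>0 - z\<^sub>e) < \<delta> \<longrightarrow>
        (\<forall>t\<in>{0..<T}. norm (Z t - z\<^sub>e) < \<epsilon>)"
    proof (intro exI[of _ "min \<epsilon> r"] conjI allI impI ballI)
      fix T z\<^sub>0 Z t
      assume "ode_solution g {0..<T} z\<^sub>0 Z \<and> norm (z\<^sub>0 - z\<^sub>e) < min \<epsilon> r" "t \<in> {0..<T}"
      then show "norm (Z t - z\<^sub>e) < \<epsilon>"
        using decay[of T z\<^sub>0 Z t] le[of t "norm (z\<^sub>0 - z\<^sub>e)"] by auto
    qed (use \<open>0 < \<epsilon>\<close> r in auto)
  qed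
  moreover have "exponentially_attracting g z\<^sub>e"
    unfolding exponentially_attracting_def
  proof -
    have "\<forall>T>0. \<forall>z\<^sub>0 Z. ode_solution g {0..<T} z\<^sub>0 Z \<and> norm (z\<^sub>0 - z\<^sub>e) < r \<longrightarrow>
        (\<forall>t\<in>{0..<T}. norm (Z t - z\<^sub>e) \<le> 1 * exp (- k * t) * norm (z\<^sub>0 - z\<^sub>e))"
      using decay by auto
    then show "\<exists>\<delta>>0. \<exists>M>0. \<exists>\<rho>>0. \<forall>T>0. \<forall>z\<^sub>0 Z.
        ode_solution g {0..<T} z\<^sub>0 Z \<and> norm (z\<^sub>0 - z\<^sub>e) < \<delta> \<longrightarrow>
        (\<forall>t\<in>{0..<T}. norm (Z t - z\<^sub>e) \<le> M * exp (- \<rho> * t) * norm (z\<^sub>0 - z\<^sub>e))"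
      using r k zero_less_one by blast
  qed
  moreover have "locally_global_solutions g z\<^sub>e"
  proof -
    define C where "C = cball z\<^sub>e (r / 2)"
    \<comment> \<open>Composing with the projection onto a compact ball makes the field bounded
      while keeping it continuous. \<open>G\<close> agrees with \<open>g\<close> inside the ball,
      and the decay estimate for \<open>G\<close> traps solutions there, so they solve the original
      equation.\<close>
    define G where "G x = g (closest_point C x)" for x
    have C: "closed C" "convex C" "C \<noteq> {}" "compact C"
      using r by (auto simp: C_def)
    have "continuous_on UNIV G"
      unfolding G_def
      by (intro continuous_on_compose2[OF cont] continuous_on_closest_point C) auto
    moreover obtain M where "\<And>x. x \<in> C \<Longrightarrow> norm (g x) \<le> M"
      using compact_imp_bounded[OF compact_continuous_image[OF continuous_on_subset[OF cont] C(4)]]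
      by (auto simp: bounded_iff)
    then have "norm (G x) \<le> M" for x
      using closest_point_in_set C by (auto simp: G_def)
    ultimately have sol: "\<exists>Z. ode_solution G {0..} z\<^sub>0 Z" for z\<^sub>0
      by (rule peano_bounded)
    have G_eq: "G x = g x" if "norm (x - z\<^sub>e) < r / 2" for x
    proof -
      have "x \<in> C" using that by (simp add: C_def dist_norm norm_minus_commute)
      then show ?thesis by (simp add: G_def closest_point_self)
    qed
    have "\<exists>Z. ode_solution g {0..} z\<^sub>0 Z" if z0: "norm (z\<^sub>0 - z\<^sub>e) < r / 2" for z\<^sub>0
    proof -
      obtain Z where Z: "ode_solution G {0..} z\<^sub>0 Z" using sol by blast
      have "norm (Z t - z\<^sub>e) < r / 2" if "0 \<le> t" for t
      proof -
        have "(Z has_vector_derivative G (Z s)) (at s within {0..t})" if "s \<in> {0..t}" for s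
          using that Z
          by (auto simp: ode_solution_def intro: has_vector_derivative_within_subset[of Z _ _ "{0..}"])
        moreover have "(x - z\<^sub>e) \<bullet> G x \<le> - k * (norm (x - z\<^sub>e))\<^sup>2" if "norm (x - z\<^sub>e) < r / 2" for x
          using that diss[of x] G_eq r by simp
        ultimately have "norm (Z t - z\<^sub>e) \<le> exp (- k * t) * norm (Z 0 - z\<^sub>e)"
          using Z z0 k that by (intro dissipative_decay[where g = G and r = "r / 2"]) (auto simp: ode_solution_def)
        then show ?thesis
          using le[OF that, of "norm (Z 0 - z\<^sub>e)"] Z z0 by (simp add: ode_solution_def)
      qed
      then have "ode_solution g {0..} z\<^sub>0 Z"
        using Z G_eq by (simp add: ode_solution_def)
      then show ?thesis by blast
    qed
    then show ?thesis
      unfolding locally_global_solutions_def using r by (intro exI[of _ "r / 2"]) auto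
  qed
  ultimately show ?thesis
    using zero by (simp add: exponentially_stable_equilibrium_def equilibrium_def)
qed

text \<open>Close to the equilibrium the linearisation error is at most \<open>c / 2\<close> times
  the distance, so half of the dissipation rate survives.\<close>

lemma exponentially_stable_if_derivative_negative:
  fixes g :: "'a::euclidean_space \<Rightarrow> 'a"
  assumes cont: "continuous_on UNIV g" and zero: "g z\<^sub>e = 0"
    and deriv: "(g has_derivative G) (at z\<^sub>e)"
    and c: "0 < c" and neg: "\<And>v. v \<bullet> G v \<le> - c * (norm v)\<^sup>2"
  shows "exponentially_stable_equilibrium g z\<^sub>e"
proof -
  obtain r where r: "0 < r"
    and approx: "\<And>x. norm (x - z\<^sub>e) < r \<Longrightarrow> norm (g x - g z\<^sub>e - G (x - z\<^sub>e)) \<le> c / 2 * norm (x - z\<^sub>e)"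
    using deriv[unfolded has_derivative_at_alt] c by (metis half_gt_zero)
  show ?thesis
  proof (rule exponentially_stable_if_dissipative[OF cont zero r])
    show "0 < c / 2" using c by simp
    fix x assume x: "norm (x - z\<^sub>e) < r"
    let ?h = "x - z\<^sub>e"
    have "?h \<bullet> (g x - G ?h) \<le> norm ?h * norm (g x - G ?h)"
      by (rule norm_cauchy_schwarz)
    also have "\<dots> \<le> norm ?h * (c / 2 * norm ?h)"
      using approx[OF x] zero by (intro mult_left_mono) auto
    finally have "?h \<bullet> g x - ?h \<bullet> G ?h \<le> c / 2 * (norm ?h)\<^sup>2"
      by (simp add: inner_diff_right power2_eq_square mult.left_commute)
    then show "?h \<bullet> g x \<le> - (c / 2) * (norm ?h)\<^sup>2"
      using neg[of ?h] by (simp add: field_simps)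
  qed
qed

subsection \<open>Continuous families of linear maps\<close>

lemma linear_basis_expansion:
  fixes T :: "'a::euclidean_space \<Rightarrow> 'b::real_vector"
  assumes "linear T"
  shows "T v = (\<Sum>b\<in>Basis. (v \<bullet> b) *\<^sub>R T b)"
proof -
  have "T v = T (\<Sum>b\<in>Basis. (v \<bullet> b) *\<^sub>R b)"
    by (simp add: euclidean_representation)
  also have "\<dots> = (\<Sum>b\<in>Basis. (v \<bullet> b) *\<^sub>R T b)"
    using assms by (simp add: linear_sum linear_scale)
  finally show ?thesis .
qed

text \<open>Expanding the argument in the finite basis reduces joint continuity to that of the
  finitely many maps \<open>\<lambda>z. S z b\<close>.\<close>

lemma isCont_linear_family:
  fixes S :: "'x::t2_space \<Rightarrow> 'a::euclidean_space \<Rightarrow> 'b::real_normed_vector"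
  assumes lin: "\<And>z. linear (S z)" and cont: "\<And>v. isCont (\<lambda>z. S z v) z\<^sub>0" and u: "isCont u z\<^sub>0"
  shows "isCont (\<lambda>z. S z (u z)) z\<^sub>0"
proof -
  have "isCont (\<lambda>z. \<Sum>b\<in>Basis. (u z \<bullet> b) *\<^sub>R S z b) z\<^sub>0"
    by (intro continuous_intros cont u)
  then show ?thesis
    by (subst linear_basis_expansion[OF lin])
qed

text \<open>In \<open>a x *\<^sub>R (c x - c z)\<close> the first factor is of the order of
  \<open>norm (x - z)\<close> and the second tends to 0, so this term has derivative 0. What remains
  is \<open>a x\<close> times the constant \<open>c z\<close>.\<close>

lemma has_derivative_scaleR_vanishing:
  fixes a :: "'a::real_normed_vector \<Rightarrow> real" and c :: "'a \<Rightarrow> 'b::real_normed_vector"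
  assumes a: "(a has_derivative a') (at z)" and zero: "a z = 0" and c: "isCont c z"
  shows "((\<lambda>x. a x *\<^sub>R c x) has_derivative (\<lambda>h. a' h *\<^sub>R c z)) (at z)"
proof -
  obtain B where B: "\<And>h. norm (a' h) \<le> norm h * B"
    using has_derivative_bounded_linear[OF a] bounded_linear.bounded by blast
  define q where "q x = norm (a x - a z - a' (x - z)) / norm (x - z)" for x
  have q: "(q \<longlongrightarrow> 0) (at z)"
    using a by (simp add: has_derivative_iff_norm q_def[abs_def])
  have "((\<lambda>x. a x *\<^sub>R (c x - c z)) has_derivative (\<lambda>_. 0)) (at z)"
  proof (rule has_derivativeI_sandwich[of 1])
    show "((\<lambda>x. (q x + B) * norm (c x - c z)) \<longlongrightarrow> 0) (at z)"
    proof -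
      have "((\<lambda>x. (q x + B) * norm (c x - c z)) \<longlongrightarrow> (0 + B) * norm (c z - c z)) (at z)"
        using c by (intro tendsto_intros q) (simp add: isCont_def)
      then show ?thesis by simp
    qed
    fix x assume x: "x \<noteq> z"
    have "\<bar>a x\<bar> \<le> norm (a x - a z - a' (x - z)) + norm (x - z) * B"
      using B[of "x - z"] zero by (simp; arith)
    then have "\<bar>a x\<bar> / norm (x - z) \<le> q x + B"
      using x by (simp add: q_def field_simps)
    then have "\<bar>a x\<bar> / norm (x - z) * norm (c x - c z) \<le> (q x + B) * norm (c x - c z)"
      by (intro mult_right_mono) auto
    then show "norm (a x *\<^sub>R (c x - c z) - a z *\<^sub>R (c z - c z) - 0) / norm (x - z)
        \<le> (q x + B) * norm (c x - c z)"
      by simp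
  qed auto
  moreover have "((\<lambda>x. a x *\<^sub>R c z) has_derivative (\<lambda>h. a' h *\<^sub>R c z)) (at z)"
    using a by (rule has_derivative_scaleR_left)
  ultimately have "((\<lambda>x. a x *\<^sub>R (c x - c z) + a x *\<^sub>R c z) has_derivative (\<lambda>h. 0 + a' h *\<^sub>R c z)) (at z)"
    by (rule has_derivative_add)
  then show ?thesis
    by (simp add: scaleR_diff_right)
qed

text \<open>A product rule at a zero of \<open>u\<close>: the term that would contain the derivative
  of \<open>S\<close> is multiplied by \<open>u z\<^sub>0 = 0\<close>, so continuity of
  \<open>S\<close> is enough. This linearises both right-hand sides although they are only known to
  be continuous elsewhere.\<close>

lemma has_derivative_linear_family_at_zero:
  fixes S :: "'x::real_normed_vector \<Rightarrow> 'a::euclidean_space \<Rightarrow> 'b::real_normed_vector"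
  assumes lin: "\<And>z. linear (S z)" and cont: "\<And>v. isCont (\<lambda>z. S z v) z\<^sub>0"
    and u: "(u has_derivative P) (at z\<^sub>0)" and zero: "u z\<^sub>0 = 0"
  shows "((\<lambda>z. S z (u z)) has_derivative (\<lambda>h. S z\<^sub>0 (P h))) (at z\<^sub>0)"
proof -
  have "((\<lambda>z. \<Sum>b\<in>Basis. (u z \<bullet> b) *\<^sub>R S z b) has_derivative (\<lambda>h. \<Sum>b\<in>Basis. (P h \<bullet> b) *\<^sub>R S z\<^sub>0 b)) (at z\<^sub>0)"
    using u zero
    by (intro has_derivative_sum has_derivative_scaleR_vanishing cont has_derivative_inner_left) auto
  then show ?thesis
    by (simp flip: linear_basis_expansion[OF lin])
qed

subsection \<open>The regularised Newton field\<close>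

text \<open>\<open>P\<close> will be the derivative of the Newton step at a zero of the field. The
  first bound gives the decay for the \<open>O(1)\<close> equation; the second limits the harm done
  by the extra \<open>P P\<close> term in the \<open>O(s)\<close> equation.\<close>

lemma shifted_monotone_linear:
  fixes J :: "'a::euclidean_space \<Rightarrow> 'a"
  assumes lin: "linear J" and inj: "inj J" and mono: "\<And>w. 0 \<le> J w \<bullet> w"
    and \<phi>: "0 < \<phi>" and bij: "bij (\<lambda>v. J v + \<phi> *\<^sub>R v)"
  defines "P \<equiv> \<lambda>v. inv (\<lambda>v. J v + \<phi> *\<^sub>R v) (J v)"
  shows "\<exists>c>0. \<forall>v. c * (norm v)\<^sup>2 \<le> v \<bullet> P v"
    and "- (v \<bullet> P v) \<le> v \<bullet> P (P v)"
proof -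
  define K where "K v = J v + \<phi> *\<^sub>R v" for v
  have K: "bij K" and P: "P v = inv K (J v)" for v
    using bij by (simp_all add: K_def[abs_def] P_def)
  have linK: "linear K"
    unfolding K_def[abs_def] using lin by (intro linear_compose_add linear_compose_scale_right linear_id[unfolded id_def])
  then have linA: "linear (inv K)"
    using K by (metis bij_is_inj inj_linear_imp_inv_linear)
  have linP: "linear P"
    unfolding P[abs_def] using linear_compose[OF lin linA] by (simp add: o_def)
  have KP: "K (P v) = J v" for v
    unfolding P using K by (simp add: bij_is_surj surj_f_inv_f)
  \<comment> \<open>\<open>J\<close> commutes with \<open>K\<close>, so \<open>v = K w\<close> gives
    \<open>P v = J w\<close>. Then \<open>v \<bullet> P v\<close> exceeds
    \<open>(norm (P v))\<^sup>2\<close> by \<open>\<phi>\<close> times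
    \<open>J w \<bullet> w\<close>.\<close>
  have coercive: "(norm (P v))\<^sup>2 \<le> v \<bullet> P v" for v
  proof -
    obtain w where w: "v = K w" using K by (metis bij_pointE)
    have "K (J w) = J v"
      using lin by (simp add: w K_def linear_add linear_scale)
    then have "P v = J w"
      using KP[of v] K by (metis bij_is_inj injD)
    then show ?thesis
      using mono[of w] \<phi> by (simp add: w K_def inner_add_left inner_add_right power2_norm_eq_inner inner_commute)
  qed
  have "inj P"
    using inj KP unfolding inj_def by metis
  then obtain B where B: "0 < B" "\<And>v. B * norm v \<le> norm (P v)"
    using linear_inj_bounded_below_pos[OF linP] by metis
  have "B\<^sup>2 * (norm v)\<^sup>2 \<le> v \<bullet> P v" for v
  proof -
    have "(B * norm v)\<^sup>2 \<le> (norm (P v))\<^sup>2"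
      using B by (intro power_mono) auto
    then show ?thesis using coercive[of v] by (simp add: power_mult_distrib)
  qed
  then show "\<exists>c>0. \<forall>v. c * (norm v)\<^sup>2 \<le> v \<bullet> P v"
    using B(1) by (intro exI[of _ "B\<^sup>2"]) auto
  text \<open>\<open>coercive\<close> says that \<open>2P - I\<close> is nonexpansive, hence so is its adjoint.\<close>
  let ?Q = "adjoint P"
  have reflect: "norm (2 *\<^sub>R P v - v) \<le> norm v" for v
  proof (rule power2_le_imp_le)
    show "(norm (2 *\<^sub>R P v - v))\<^sup>2 \<le> (norm v)\<^sup>2"
      using coercive[of v]
      by (simp add: power2_norm_eq_inner inner_diff_left inner_diff_right inner_commute)
  qed simp
  have reflect_adj: "norm (2 *\<^sub>R ?Q v - v) \<le> norm v" for v
  proof -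
    let ?r = "2 *\<^sub>R ?Q v - v"
    have "(norm ?r)\<^sup>2 = ?r \<bullet> ?r"
      by (simp add: power2_norm_eq_inner)
    also have "\<dots> = (2 *\<^sub>R P ?r - ?r) \<bullet> v"
      using adjoint_works[OF linP, of ?r v] by (simp add: inner_diff_left inner_diff_right inner_commute)
    also have "\<dots> \<le> norm (2 *\<^sub>R P ?r - ?r) * norm v"
      by (rule norm_cauchy_schwarz)
    also have "\<dots> \<le> norm ?r * norm v"
      by (intro mult_right_mono reflect) auto
    finally show ?thesis
      by (cases "norm ?r = 0") (auto simp: power2_eq_square)
  qed
  have coercive_adj: "(norm (?Q v))\<^sup>2 \<le> v \<bullet> P v"
  proof -
    have "(norm (2 *\<^sub>R ?Q v - v))\<^sup>2 \<le> (norm v)\<^sup>2"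
      using reflect_adj by (intro power_mono) auto
    then have "(norm (?Q v))\<^sup>2 \<le> v \<bullet> ?Q v"
      by (simp add: power2_norm_eq_inner inner_diff_left inner_diff_right inner_commute)
    then show ?thesis
      using adjoint_works[OF linP, of v v] by (simp add: inner_commute)
  qed
  \<comment> \<open>One factor \<open>P\<close> moves to the other side as its adjoint; both
    resulting squared norms are at most \<open>v \<bullet> P v\<close>.\<close>
  have "- (v \<bullet> P (P v)) = - (?Q v \<bullet> P v)"
    using adjoint_works[OF linP, of "P v" v] by (simp add: inner_commute)
  also have "\<dots> \<le> norm (?Q v) * norm (P v)"
    using norm_cauchy_schwarz[of "- ?Q v" "P v"] by simp
  also have "\<dots> \<le> ((norm (?Q v))\<^sup>2 + (norm (P v))\<^sup>2) / 2"
    using sum_squares_bound[of "norm (?Q v)" "norm (P v)"] by simp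
  also have "\<dots> \<le> v \<bullet> P v"
    using coercive[of v] coercive_adj by simp
  finally show "- (v \<bullet> P v) \<le> v \<bullet> P (P v)" by simp
qed

text \<open>Difference quotients of \<open>F\<close> along \<open>v\<close> have norm at most
  \<open>L * norm v\<close>, and the linearisation error vanishes in the limit.\<close>

lemma norm_frechet_derivative_le_lipschitz:
  fixes F :: "'a::real_normed_vector \<Rightarrow> 'b::real_normed_vector"
  assumes lip: "L-lipschitz_on UNIV F" and deriv: "(F has_derivative F') (at z)"
  shows "norm (F' v) \<le> L * norm v"
proof -
  have "((\<lambda>t. F (z + t *\<^sub>R v)) has_derivative (\<lambda>t. F' (t *\<^sub>R v))) (at 0)"
    by (rule has_derivative_compose[of "\<lambda>t. z + t *\<^sub>R v" _ _ _ F F'])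
      (auto intro!: derivative_eq_intros simp: deriv)
  then have lim: "(\<lambda>t. norm (F (z + t *\<^sub>R v) - F z - F' (t *\<^sub>R v)) / norm t) \<midarrow>0\<rightarrow> 0"
    by (simp add: has_derivative_at)
  have "linear F'" using deriv has_derivative_linear by blast
  have "norm (F' v) - L * norm v \<le> norm (F (z + t *\<^sub>R v) - F z - F' (t *\<^sub>R v)) / norm t"
    if "t \<noteq> 0" for t
  proof -
    have "norm (F' (t *\<^sub>R v)) \<le> norm (F (z + t *\<^sub>R v) - F z) + norm (F (z + t *\<^sub>R v) - F z - F' (t *\<^sub>R v))"
      by norm
    moreover have "norm (F (z + t *\<^sub>R v) - F z) \<le> L * (\<bar>t\<bar> * norm v)"
      using lipschitz_onD[OF lip, of "z + t *\<^sub>R v" z] by (simp add: dist_norm)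
    moreover have "norm (F' (t *\<^sub>R v)) = \<bar>t\<bar> * norm (F' v)"
      using \<open>linear F'\<close> by (simp add: linear_scale)
    ultimately show ?thesis
      using that by (simp add: field_simps)
  qed
  then have "\<forall>\<^sub>F t in at 0. norm (F' v) - L * norm v \<le> norm (F (z + t *\<^sub>R v) - F z - F' (t *\<^sub>R v)) / norm t"
    by (simp add: eventually_at_filter)
  then have "norm (F' v) - L * norm v \<le> 0"
    by (rule tendsto_lowerbound[OF lim]) simp
  then show ?thesis by simp
qed

section \<open>The Newton step of a Lipschitz field of class C^1, and the \<open>O(1)\<close>
  equation\<close>

locale regularised_newton =
  fixes F :: "'a::euclidean_space \<Rightarrow> 'a" and L \<phi> :: real
  assumes C1: "C_k 1 F" and lip: "L-lipschitz_on UNIV F" and \<phi>: "L < \<phi>"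
begin

text \<open>The common factor of both right-hand sides: the \<open>O(1)\<close> field is its
  negative, and the \<open>O(s)\<close> field is a state-dependent linear map applied to it.\<close>

definition newton_step :: "'a \<Rightarrow> 'a" where
  "newton_step z = reg_inverse F \<phi> z (F z)"

lemma has_derivative_F: "(F has_derivative jacobian_map F z) (at z)"
  using C1 by (simp add: jacobian_map_def frechet_derivative_works)

lemma linear_jacobian: "linear (jacobian_map F z)"
  using has_derivative_F has_derivative_linear by blast

lemma isCont_jacobian: "isCont (\<lambda>z. jacobian_map F z v) z"
  using C1 by (simp add: jacobian_map_def continuous_on_eq_continuous_at)

lemma shift_pos: "0 < \<phi>"
  using \<phi> lipschitz_on_nonneg[OF lip] by simp

text \<open>The Jacobian has norm at most \<open>L < \<phi>\<close>, so the shift dominates. The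
  bound is uniform in \<open>z\<close>, which yields both invertibility and the continuity of the
  inverse.\<close>

lemma shifted_lower_bound: "(\<phi> - L) * norm v \<le> norm (jacobian_map F z v + \<phi> *\<^sub>R v)"
proof -
  have "norm (\<phi> *\<^sub>R v) \<le> norm (jacobian_map F z v + \<phi> *\<^sub>R v) + norm (jacobian_map F z v)"
    using norm_triangle_ineq4[of "jacobian_map F z v + \<phi> *\<^sub>R v" "jacobian_map F z v"] by simp
  moreover have "norm (jacobian_map F z v) \<le> L * norm v"
    using norm_frechet_derivative_le_lipschitz[OF lip has_derivative_F] .
  ultimately show ?thesis
    using shift_pos by (simp add: left_diff_distrib)
qed

lemma linear_shifted: "linear (\<lambda>v. jacobian_map F z v + \<phi> *\<^sub>R v)"
  using linear_jacobian
  by (intro linear_compose_add linear_compose_scale_right linear_id[unfolded id_def])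

lemma bij_shifted: "bij (\<lambda>v. jacobian_map F z v + \<phi> *\<^sub>R v)"
proof -
  have "v = 0" if "jacobian_map F z v + \<phi> *\<^sub>R v = 0" for v
    using shifted_lower_bound[of v z] \<phi> that by (simp add: mult_le_0_iff)
  then have "inj (\<lambda>v. jacobian_map F z v + \<phi> *\<^sub>R v)"
    using linear_injective_0[OF linear_shifted] by blast
  then show ?thesis
    using linear_injective_imp_surjective[OF linear_shifted] by (simp add: bij_def)
qed

lemma linear_reg_inverse: "linear (reg_inverse F \<phi> z)"
  unfolding reg_inverse_def
  using bij_shifted linear_shifted by (metis bij_is_inj inj_linear_imp_inv_linear)

lemma reg_inverse_solves: "jacobian_map F z (reg_inverse F \<phi> z w) + \<phi> *\<^sub>R reg_inverse F \<phi> z w = w"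
  using surj_f_inv_f[OF bij_is_surj[OF bij_shifted[of z]], of w] by (simp add: reg_inverse_def)

text \<open>The resolvent identity: the difference of the solutions at \<open>y\<close> and
  \<open>z\<close> is the inverse at \<open>y\<close> applied to the change of the Jacobian on the
  fixed vector \<open>a\<close>, and that inverse has norm at most
  \<open>1 / (\<phi> - L)\<close>.\<close>

lemma isCont_reg_inverse: "isCont (\<lambda>z. reg_inverse F \<phi> z w) z"
proof -
  define a where "a = reg_inverse F \<phi> z w"
  have bound: "norm (reg_inverse F \<phi> y w - a) \<le> norm (jacobian_map F z a - jacobian_map F y a) / (\<phi> - L)" for y
  proof -
    let ?d = "reg_inverse F \<phi> y w - a"
    have "jacobian_map F y ?d + \<phi> *\<^sub>R ?d = w - (jacobian_map F y a + \<phi> *\<^sub>R a)"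
      using reg_inverse_solves[of y w] by (simp add: linear_diff[OF linear_jacobian] algebra_simps)
    also have "\<dots> = jacobian_map F z a - jacobian_map F y a"
      using reg_inverse_solves[of z w] by (simp add: a_def algebra_simps)
    finally show ?thesis
      using shifted_lower_bound[of ?d y] \<phi> by (simp add: pos_le_divide_eq mult.commute)
  qed
  have lim: "((\<lambda>y. norm (jacobian_map F z a - jacobian_map F y a) / (\<phi> - L)) \<longlongrightarrow> 0) (at z)"
  proof -
    have "((\<lambda>y. norm (jacobian_map F z a - jacobian_map F y a) / (\<phi> - L)) \<longlongrightarrow>
        norm (jacobian_map F z a - jacobian_map F z a) / (\<phi> - L)) (at z)"
      using isCont_jacobian[where v = a] \<phi> by (intro tendsto_intros) (auto simp: isCont_def)
    then show ?thesis by simp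
  qed
  have "((\<lambda>y. reg_inverse F \<phi> y w - a) \<longlongrightarrow> 0) (at z)"
    by (rule Lim_null_comparison[OF always_eventually lim]) (simp add: bound)
  then show ?thesis
    unfolding isCont_def a_def[symmetric] by (rule LIM_zero_cancel)
qed

lemma isCont_newton_step: "isCont newton_step z"
  unfolding newton_step_def[abs_def]
  using isCont_linear_family[where S = "reg_inverse F \<phi>" and u = F, OF linear_reg_inverse
      isCont_reg_inverse has_derivative_continuous[OF has_derivative_F]] .

lemma has_derivative_newton_step:
  assumes "F z = 0"
  shows "(newton_step has_derivative (\<lambda>v. reg_inverse F \<phi> z (jacobian_map F z v))) (at z)"
  unfolding newton_step_def[abs_def]
  using has_derivative_linear_family_at_zero[where S = "reg_inverse F \<phi>" and u = F,
      OF linear_reg_inverse isCont_reg_inverse has_derivative_F assms] .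

lemma newton_step_zero: "F z = 0 \<Longrightarrow> newton_step z = 0"
  by (simp add: newton_step_def linear_0[OF linear_reg_inverse])

lemma newton_derivative_coercive:
  assumes mono: "\<And>w. 0 \<le> jacobian_map F z w \<bullet> w" and inj: "inj (jacobian_map F z)"
  obtains c where "0 < c" "\<And>v. c * (norm v)\<^sup>2 \<le> v \<bullet> reg_inverse F \<phi> z (jacobian_map F z v)"
  using shifted_monotone_linear(1)[OF linear_jacobian inj mono shift_pos bij_shifted]
  unfolding reg_inverse_def[symmetric] by metis

lemma newton_derivative_square_bound:
  fixes z v :: 'a
  assumes mono: "\<And>w. 0 \<le> jacobian_map F z w \<bullet> w" and inj: "inj (jacobian_map F z)"
  defines "P \<equiv> \<lambda>v. reg_inverse F \<phi> z (jacobian_map F z v)"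
  shows "- (v \<bullet> P v) \<le> v \<bullet> P (P v)"
  unfolding P_def reg_inverse_def
  by (rule shifted_monotone_linear(2)[OF linear_jacobian inj mono shift_pos bij_shifted])

theorem exponentially_stable_O1:
  assumes zero: "F z = 0"
    and mono: "\<And>w. 0 \<le> jacobian_map F z w \<bullet> w" and inj: "inj (jacobian_map F z)"
  shows "exponentially_stable_equilibrium (rdn_ode_O1 F \<phi>) z"
proof -
  obtain c where c: "0 < c"
    "\<And>v. c * (norm v)\<^sup>2 \<le> v \<bullet> reg_inverse F \<phi> z (jacobian_map F z v)"
    using newton_derivative_coercive[OF mono inj] by metis
  have eq: "rdn_ode_O1 F \<phi> = (\<lambda>z. - newton_step z)"
    by (simp add: fun_eq_iff rdn_ode_O1_def newton_step_def)
  show ?thesis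
  proof (rule exponentially_stable_if_derivative_negative)
    show "continuous_on UNIV (rdn_ode_O1 F \<phi>)"
      unfolding eq by (simp add: continuous_on_eq_continuous_at isCont_newton_step)
    show "(rdn_ode_O1 F \<phi> has_derivative (\<lambda>v. - reg_inverse F \<phi> z (jacobian_map F z v))) (at z)"
      unfolding eq by (intro has_derivative_minus has_derivative_newton_step zero)
    show "rdn_ode_O1 F \<phi> z = 0"
      using newton_step_zero[OF zero] by (simp add: eq)
  qed (use c in auto)
qed

section \<open>The \<open>O(s)\<close> equation\<close>

context
  assumes C2: "\<And>e. C_k 1 (\<lambda>z. jacobian_map F z e)"
begin

lemma has_derivative_jacobian:
  "((\<lambda>w. jacobian_map F w e) has_derivative (\<lambda>v. second_derivative F z v e)) (at z)"
  using C2[of e] unfolding second_derivative_def by (simp add: frechet_derivative_works)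

lemma linear_second_derivative_left: "linear (\<lambda>v. second_derivative F z v e)"
  using has_derivative_jacobian has_derivative_linear by blast

text \<open>In this slot linearity is inherited from the Jacobian, by uniqueness of
  derivatives.\<close>

lemma linear_second_derivative_right: "linear (second_derivative F z v)"
proof (rule linearI)
  fix x y :: 'a and r :: real
  have "((\<lambda>w. jacobian_map F w (x + y)) has_derivative
      (\<lambda>v. second_derivative F z v x + second_derivative F z v y)) (at z)"
    using has_derivative_add[OF has_derivative_jacobian[of x z] has_derivative_jacobian[of y z]]
    by (simp add: linear_add[OF linear_jacobian])
  from has_derivative_unique[OF has_derivative_jacobian this]
  show "second_derivative F z v (x + y) = second_derivative F z v x + second_derivative F z v y"
    by (rule fun_cong)
  have "((\<lambda>w. jacobian_map F w (r *\<^sub>R x)) has_derivative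
      (\<lambda>v. r *\<^sub>R second_derivative F z v x)) (at z)"
    using has_derivative_scaleR_right[OF has_derivative_jacobian[of x z], of r]
    by (simp add: linear_scale[OF linear_jacobian])
  from has_derivative_unique[OF has_derivative_jacobian this]
  show "second_derivative F z v (r *\<^sub>R x) = r *\<^sub>R second_derivative F z v x"
    by (rule fun_cong)
qed

lemma isCont_second_derivative: "isCont (\<lambda>z. second_derivative F z v e) z"
  using C2[of e] unfolding second_derivative_def by (simp add: continuous_on_eq_continuous_at)

theorem exponentially_stable_Os:
  assumes zero: "F z = 0"
    and mono: "\<And>w. 0 \<le> jacobian_map F z w \<bullet> w" and inj: "inj (jacobian_map F z)"
    and s: "0 < s" "s < 2"
  shows "exponentially_stable_equilibrium (rdn_ode_Os F \<phi> s) z"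
proof -
  define P where "P v = reg_inverse F \<phi> z (jacobian_map F z v)" for v
  obtain c where c: "0 < c" "\<And>v. c * (norm v)\<^sup>2 \<le> v \<bullet> P v"
    using newton_derivative_coercive[OF mono inj] unfolding P_def by metis
  have PP: "- (v \<bullet> P v) \<le> v \<bullet> P (P v)" for v
    using newton_derivative_square_bound[OF mono inj] unfolding P_def .
  \<comment> \<open>The bracket of the \<open>O(s)\<close> field, a linear map in \<open>v\<close>
    that depends continuously on the state. At the equilibrium the Newton step is 0, and the
    second-derivative term disappears from it.\<close>
  define S where "S z v = - v - (s / 2) *\<^sub>R (reg_inverse F \<phi> z (jacobian_map F z v)
      - reg_inverse F \<phi> z (second_derivative F z v (newton_step z)))" for z v
  have eq: "rdn_ode_Os F \<phi> s = (\<lambda>z. S z (newton_step z))"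
    by (simp add: fun_eq_iff rdn_ode_Os_def newton_step_def S_def Let_def)
  have linS: "linear (S y)" for y
    unfolding S_def[abs_def]
    by (intro linear_compose_sub linear_compose_scale_right linear_compose_neg
        linear_compose[OF linear_jacobian linear_reg_inverse, unfolded o_def]
        linear_compose[OF linear_second_derivative_left linear_reg_inverse, unfolded o_def]
        linear_id[unfolded id_def])
  have contS: "isCont (\<lambda>y. S y v) y" for v y
  proof -
    have A: "isCont (\<lambda>y. reg_inverse F \<phi> y (w y)) y" if "isCont w y" for w y
      by (rule isCont_linear_family[where S = "reg_inverse F \<phi>", OF linear_reg_inverse isCont_reg_inverse that])
    have "isCont (\<lambda>y. second_derivative F y v (newton_step y)) y"
      by (rule isCont_linear_family[where S = "\<lambda>y. second_derivative F y v",
            OF linear_second_derivative_right isCont_second_derivative isCont_newton_step])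
    then show ?thesis
      unfolding S_def by (intro continuous_intros A isCont_jacobian)
  qed
  have Sz: "S z v = - v - (s / 2) *\<^sub>R P v" for v
    by (simp add: S_def P_def newton_step_zero[OF zero] linear_0[OF linear_second_derivative_right]
        linear_0[OF linear_reg_inverse])
  show ?thesis
  proof (rule exponentially_stable_if_derivative_negative)
    show "continuous_on UNIV (rdn_ode_Os F \<phi> s)"
      unfolding eq
      using isCont_linear_family[where S = S and u = newton_step, OF linS contS isCont_newton_step]
      by (simp add: continuous_on_eq_continuous_at)
    show "rdn_ode_Os F \<phi> s z = 0"
      by (simp add: eq newton_step_zero[OF zero] linear_0[OF linS])
    show "(rdn_ode_Os F \<phi> s has_derivative (\<lambda>v. S z (P v))) (at z)"
      unfolding eq P_def
      using has_derivative_linear_family_at_zero[where S = S and u = newton_step,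
          OF linS contS has_derivative_newton_step[OF zero] newton_step_zero[OF zero]] .
    \<comment> \<open>The extra term costs at most \<open>s / 2\<close> times
      \<open>v \<bullet> P v\<close>; this is where the restriction \<open>s < 2\<close> comes
      from.\<close>
    show "0 < (1 - s / 2) * c" using s c by simp
    fix v
    have "v \<bullet> S z (P v) = - (v \<bullet> P v) - s / 2 * (v \<bullet> P (P v))"
      by (simp add: Sz inner_diff_right)
    also have "\<dots> \<le> - (v \<bullet> P v) + s / 2 * (v \<bullet> P v)"
      using mult_left_mono[OF PP[of v], of "s / 2"] s by simp
    also have "\<dots> = - ((1 - s / 2) * (v \<bullet> P v))"
      by (simp add: algebra_simps)
    also have "\<dots> \<le> - ((1 - s / 2) * (c * (norm v)\<^sup>2))"
      using mult_left_mono[OF c(2)[of v], of "1 - s / 2"] s by simp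
    finally show "v \<bullet> S z (P v) \<le> - ((1 - s / 2) * c) * (norm v)\<^sup>2"
      by (simp add: mult.assoc)
  qed
qed

end

end

subsection \<open>Second derivatives\<close>

lemma has_derivative_sum_scaleR:
  assumes "\<And>b. b \<in> B \<Longrightarrow> c b differentiable (at z)"
  shows "((\<lambda>z. \<Sum>b\<in>B. c b z *\<^sub>R d b) has_derivative
      (\<lambda>v. \<Sum>b\<in>B. frechet_derivative (c b) (at z) v *\<^sub>R d b)) (at z)"
  using assms by (intro has_derivative_sum has_derivative_scaleR_left) (simp add: frechet_derivative_works)

text \<open>The gradient, the saddle field and the Jacobian of the latter in a fixed direction are
  all sums of this shape, with partial derivatives of \<open>f\<close> as coefficients.\<close>

lemma C_1_sum_scaleR:
  fixes c :: "'b \<Rightarrow> 'a::euclidean_space \<Rightarrow> real" and d :: "'b \<Rightarrow> 'c::real_normed_vector"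
  assumes "\<And>b. b \<in> B \<Longrightarrow> C_k 1 (c b)"
  shows "C_k 1 (\<lambda>z. \<Sum>b\<in>B. c b z *\<^sub>R d b)"
    and "frechet_derivative (\<lambda>z. \<Sum>b\<in>B. c b z *\<^sub>R d b) (at z) v
      = (\<Sum>b\<in>B. frechet_derivative (c b) (at z) v *\<^sub>R d b)"
proof -
  have deriv: "((\<lambda>z. \<Sum>b\<in>B. c b z *\<^sub>R d b) has_derivative
      (\<lambda>v. \<Sum>b\<in>B. frechet_derivative (c b) (at z) v *\<^sub>R d b)) (at z)" for z
    using assms by (intro has_derivative_sum_scaleR) simp
  have eq: "frechet_derivative (\<lambda>z. \<Sum>b\<in>B. c b z *\<^sub>R d b) (at z)
      = (\<lambda>v. \<Sum>b\<in>B. frechet_derivative (c b) (at z) v *\<^sub>R d b)" for z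
    by (rule frechet_derivative_at[OF deriv, symmetric])
  show "frechet_derivative (\<lambda>z. \<Sum>b\<in>B. c b z *\<^sub>R d b) (at z) v
      = (\<Sum>b\<in>B. frechet_derivative (c b) (at z) v *\<^sub>R d b)"
    by (simp add: eq)
  show "C_k 1 (\<lambda>z. \<Sum>b\<in>B. c b z *\<^sub>R d b)"
    using assms
    by (auto simp: eq intro!: differentiableI[OF deriv] continuous_on_sum continuous_on_scaleR)
qed

lemma gradient_eqI:
  assumes "GDERIV f z :> g" shows "gradient f z = g"
proof -
  have "g' = g" if "GDERIV f z :> g'" for g'
    using has_derivative_unique[OF that[unfolded gderiv_def] assms[unfolded gderiv_def]]
    by (metis vector_eq_rdot inner_commute)
  then show ?thesis
    unfolding gradient_def using assms by blast
qed

lemma gderiv_gradient: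
  assumes "f differentiable (at z)"
  shows "GDERIV f z :> gradient f z"
    and "gradient f z = (\<Sum>b\<in>Basis. frechet_derivative f (at z) b *\<^sub>R b)"
proof -
  let ?D = "frechet_derivative f (at z)" let ?g = "\<Sum>b\<in>Basis. ?D b *\<^sub>R b"
  have D: "(f has_derivative ?D) (at z)"
    using assms by (simp add: frechet_derivative_works)
  then have lin: "linear ?D" by (rule has_derivative_linear)
  have "?D h = h \<bullet> ?g" for h
  proof -
    have "?D h = ?D (\<Sum>b\<in>Basis. (h \<bullet> b) *\<^sub>R b)"
      by (simp add: euclidean_representation)
    also have "\<dots> = h \<bullet> ?g"
      using lin by (simp add: linear_sum linear_scale inner_sum_right mult.commute)
    finally show ?thesis .
  qed
  then have "?D = (\<lambda>h. h \<bullet> ?g)" by blast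
  then have "GDERIV f z :> ?g"
    using D by (simp add: gderiv_def)
  then show "GDERIV f z :> gradient f z" "gradient f z = ?g"
    using gradient_eqI by metis+
qed

lemma has_real_derivative_along_line:
  fixes f :: "'a::real_normed_vector \<Rightarrow> real"
  assumes "f differentiable (at (z + t *\<^sub>R v))"
  shows "((\<lambda>t. f (z + t *\<^sub>R v)) has_real_derivative frechet_derivative f (at (z + t *\<^sub>R v)) v) (at t)"
proof -
  let ?D = "frechet_derivative f (at (z + t *\<^sub>R v))"
  have D: "(f has_derivative ?D) (at (z + t *\<^sub>R v))"
    using assms by (simp add: frechet_derivative_works)
  have "((\<lambda>t. f (z + t *\<^sub>R v)) has_derivative (\<lambda>t. ?D (t *\<^sub>R v))) (at t)"
    by (rule has_derivative_compose[of "\<lambda>t. z + t *\<^sub>R v" _ _ _ f ?D])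
      (auto intro!: derivative_eq_intros simp: D)
  then show ?thesis
    unfolding has_field_derivative_def
    by (rule has_derivative_eq_rhs)
      (simp add: fun_eq_iff linear_scale[OF has_derivative_linear[OF D]] mult.commute)
qed

text \<open>The mean value theorem is applied first in direction \<open>a\<close>, to the increment
  of \<open>f\<close> in direction \<open>b\<close>, and then in direction \<open>b\<close>, to the
  derivative along \<open>a\<close>.\<close>

lemma mixed_difference_mean_value:
  fixes f :: "'a::real_normed_vector \<Rightarrow> real"
  defines "D \<equiv> \<lambda>g v z. frechet_derivative g (at z) v"
  assumes f: "\<And>z. f differentiable (at z)" and Df: "\<And>z. D f a differentiable (at z)" and h: "0 < h"
  obtains \<xi> \<eta> where "0 < \<xi>" "\<xi> < h" "0 < \<eta>" "\<eta> < h"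
    "f (z + h *\<^sub>R a + h *\<^sub>R b) - f (z + h *\<^sub>R a) - f (z + h *\<^sub>R b) + f z
      = h\<^sup>2 * D (D f a) b (z + \<xi> *\<^sub>R a + \<eta> *\<^sub>R b)"
proof -
  let ?\<psi> = "\<lambda>s. f (z + h *\<^sub>R b + s *\<^sub>R a) - f (z + s *\<^sub>R a)"
  have "\<exists>\<xi>>0. \<xi> < h \<and> ?\<psi> h - ?\<psi> 0 = (h - 0) * (D f a (z + h *\<^sub>R b + \<xi> *\<^sub>R a) - D f a (z + \<xi> *\<^sub>R a))"
    unfolding D_def using h by (intro MVT2 DERIV_diff has_real_derivative_along_line f)
  then obtain \<xi> where \<xi>: "0 < \<xi>" "\<xi> < h"
    "?\<psi> h - ?\<psi> 0 = h * (D f a (z + h *\<^sub>R b + \<xi> *\<^sub>R a) - D f a (z + \<xi> *\<^sub>R a))"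
    by auto
  let ?\<chi> = "\<lambda>t. D f a (z + \<xi> *\<^sub>R a + t *\<^sub>R b)"
  have "\<exists>\<eta>>0. \<eta> < h \<and> ?\<chi> h - ?\<chi> 0 = (h - 0) * D (D f a) b (z + \<xi> *\<^sub>R a + \<eta> *\<^sub>R b)"
    using h has_real_derivative_along_line[OF Df] unfolding D_def by (intro MVT2) auto
  then obtain \<eta> where \<eta>: "0 < \<eta>" "\<eta> < h"
    "?\<chi> h - ?\<chi> 0 = h * D (D f a) b (z + \<xi> *\<^sub>R a + \<eta> *\<^sub>R b)"
    by auto
  have "f (z + h *\<^sub>R a + h *\<^sub>R b) - f (z + h *\<^sub>R a) - f (z + h *\<^sub>R b) + f z = ?\<psi> h - ?\<psi> 0"
    by (simp add: add_ac)
  also have "\<dots> = h * (?\<chi> h - ?\<chi> 0)"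
    using \<xi>(3) by (simp add: add_ac)
  also have "\<dots> = h\<^sup>2 * D (D f a) b (z + \<xi> *\<^sub>R a + \<eta> *\<^sub>R b)"
    by (simp only: \<eta>(3) power2_eq_square mult.assoc)
  finally show ?thesis using that \<xi> \<eta> by blast
qed

text \<open>Schwarz's theorem: the second difference is symmetric in the two directions, and divided
  by the squared step it tends to the mixed derivative in either order.\<close>

lemma second_derivative_symmetric:
  fixes f :: "'a::euclidean_space \<Rightarrow> real"
  assumes C2: "C_k 2 f"
  defines "D \<equiv> \<lambda>g v z. frechet_derivative g (at z) v"
  shows "D (D f a) b z = D (D f b) a z"
proof -
  define h where "h n = 1 / real (Suc n)" for n
  define \<Delta> where "\<Delta> v w n = f (z + h n *\<^sub>R v + h n *\<^sub>R w) - f (z + h n *\<^sub>R v) - f (z + h n *\<^sub>R w) + f z"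
    for v w n
  have h: "0 < h n" for n by (simp add: h_def)
  have h_0: "h \<longlonglongrightarrow> 0"
    unfolding h_def using LIMSEQ_inverse_real_of_nat by (simp add: inverse_eq_divide)
  have f: "f differentiable (at x)" and Df: "D f v differentiable (at x)"
    and contD: "isCont (D (D f v) w) x" for x v w
    using C2 by (simp_all add: numeral_2_eq_2 D_def continuous_on_eq_continuous_at)
  have lim: "(\<lambda>n. \<Delta> v w n / (h n)\<^sup>2) \<longlonglongrightarrow> D (D f v) w z" for v w
  proof -
    have "\<exists>\<xi> \<eta>. 0 < \<xi> \<and> \<xi> < h n \<and> 0 < \<eta> \<and> \<eta> < h n \<and>
        \<Delta> v w n = (h n)\<^sup>2 * D (D f v) w (z + \<xi> *\<^sub>R v + \<eta> *\<^sub>R w)" for n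
      unfolding \<Delta>_def D_def
      using mixed_difference_mean_value[where a = v and b = w and h = "h n" and z = z, OF f Df[unfolded D_def] h] by metis
    then obtain \<xi> \<eta> where \<xi>: "\<And>n. 0 < \<xi> n" "\<And>n. \<xi> n < h n"
      and \<eta>: "\<And>n. 0 < \<eta> n" "\<And>n. \<eta> n < h n"
      and eq: "\<And>n. \<Delta> v w n = (h n)\<^sup>2 * D (D f v) w (z + \<xi> n *\<^sub>R v + \<eta> n *\<^sub>R w)"
      by metis
    have "\<xi> \<longlonglongrightarrow> 0" "\<eta> \<longlonglongrightarrow> 0"
      using \<xi> \<eta> by (auto intro!: tendsto_sandwich[OF _ _ tendsto_const h_0] always_eventually less_imp_le)
    then have "(\<lambda>n. z + \<xi> n *\<^sub>R v + \<eta> n *\<^sub>R w) \<longlonglongrightarrow> z + 0 *\<^sub>R v + 0 *\<^sub>R w"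
      by (intro tendsto_intros)
    then have "(\<lambda>n. D (D f v) w (z + \<xi> n *\<^sub>R v + \<eta> n *\<^sub>R w)) \<longlonglongrightarrow> D (D f v) w z"
      using isCont_tendsto_compose[OF contD] by fastforce
    moreover have "D (D f v) w (z + \<xi> n *\<^sub>R v + \<eta> n *\<^sub>R w) = \<Delta> v w n / (h n)\<^sup>2" for n
      using h[of n] by (simp add: eq)
    ultimately show ?thesis by simp
  qed
  have "\<Delta> a b n = \<Delta> b a n" for n
    by (simp add: \<Delta>_def add_ac)
  then show ?thesis
    using lim[of a b] lim[of b a] LIMSEQ_unique by (simp; blast)
qed

text \<open>If \<open>l\<close> were negative, \<open>q\<close> would be negative just to the right
  of 0, and by the mean value theorem \<open>p\<close> would fall below \<open>p 0\<close>
  there.\<close>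

lemma second_derivative_test:
  fixes p :: "real \<Rightarrow> real"
  assumes p: "\<And>t. (p has_real_derivative q t) (at t)" and q: "(q has_real_derivative l) (at 0)"
    and d: "0 < d" and min: "\<And>t. \<bar>t\<bar> < d \<Longrightarrow> p 0 \<le> p t"
  shows "q 0 = 0" and "0 \<le> l"
proof -
  show q0: "q 0 = 0"
    using DERIV_local_min[OF p d] min by simp
  show "0 \<le> l"
  proof (rule ccontr)
    assume "\<not> 0 \<le> l"
    then obtain e where e: "0 < e" "\<And>t. 0 < t \<Longrightarrow> t < e \<Longrightarrow> q t < 0"
      using DERIV_neg_dec_right[OF q] q0 by auto
    define t where "t = min d e / 2"
    have t: "0 < t" "t < d" "t < e" using d e by (auto simp: t_def)
    obtain s where "0 < s" "s < t" "p t - p 0 = (t - 0) * q s"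
      using MVT2[of 0 t p q] p t by blast
    then have "p t < p 0"
      using e(2)[of s] t mult_pos_neg[of t "q s"] by simp
    then show False using min[of t] t by simp
  qed
qed

section \<open>Gradient and Hessian of a C^2 function\<close>

locale C2_function =
  fixes f :: "'a::euclidean_space \<Rightarrow> real"
  assumes C2: "C_k 2 f"
begin

lemma differentiable_f: "f differentiable (at z)"
  using C2 by (simp add: numeral_2_eq_2)

lemma C1_partial: "C_k 1 (\<lambda>z. frechet_derivative f (at z) v)"
  using C2 by (simp add: numeral_2_eq_2)

lemma C1_second_partial:
  assumes "C_k 3 f"
  shows "C_k 1 (\<lambda>z. frechet_derivative (\<lambda>z. frechet_derivative f (at z) v) (at z) w)"
  using assms by (simp add: numeral_3_eq_3)

lemma hessian_map_eq:
  "hessian_map f z v = (\<Sum>b\<in>Basis. frechet_derivative (\<lambda>z. frechet_derivative f (at z) b) (at z) v *\<^sub>R b)"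
proof -
  have "gradient f = (\<lambda>z. \<Sum>b\<in>Basis. frechet_derivative f (at z) b *\<^sub>R b)"
    using gderiv_gradient(2)[OF differentiable_f] by blast
  then show ?thesis
    unfolding hessian_map_def jacobian_map_def using C_1_sum_scaleR(2)[OF C1_partial] by simp
qed

lemma frechet_derivative_eq_inner_gradient: "frechet_derivative f (at z) v = v \<bullet> gradient f z"
  using gderiv_gradient(1)[OF differentiable_f] frechet_derivative_at unfolding gderiv_def by metis

lemma has_derivative_gradient: "(gradient f has_derivative hessian_map f z) (at z)"
proof -
  have "gradient f = (\<lambda>z. \<Sum>b\<in>Basis. frechet_derivative f (at z) b *\<^sub>R b)"
    using gderiv_gradient(2)[OF differentiable_f] by blast
  then show ?thesis
    unfolding hessian_map_eq[abs_def]
    using has_derivative_sum_scaleR[of Basis "\<lambda>b z. frechet_derivative f (at z) b" z "\<lambda>b. b"] C1_partial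
    by simp
qed

text \<open>Links the Hessian, defined through the gradient, to iterated directional derivatives,
  for which symmetry and the test along lines are available.\<close>

lemma inner_hessian_map:
  "w \<bullet> hessian_map f z v = frechet_derivative (\<lambda>z. frechet_derivative f (at z) w) (at z) v"
proof -
  have "((\<lambda>z. frechet_derivative f (at z) w) has_derivative (\<lambda>v. w \<bullet> hessian_map f z v)) (at z)"
    unfolding frechet_derivative_eq_inner_gradient
    by (intro has_derivative_inner_right has_derivative_gradient)
  then show ?thesis
    using frechet_derivative_at by metis
qed

lemma hessian_map_symmetric: "w \<bullet> hessian_map f z v = v \<bullet> hessian_map f z w"
  unfolding inner_hessian_map by (rule second_derivative_symmetric[OF C2])

lemma local_minimum_along:
  assumes "0 < d" and "\<And>t. \<bar>t\<bar> < d \<Longrightarrow> f z \<le> f (z + t *\<^sub>R w)"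
  shows "w \<bullet> gradient f z = 0" and "0 \<le> w \<bullet> hessian_map f z w"
proof -
  have p: "((\<lambda>t. f (z + t *\<^sub>R w)) has_real_derivative frechet_derivative f (at (z + t *\<^sub>R w)) w) (at t)" for t
    by (intro has_real_derivative_along_line differentiable_f)
  have q: "((\<lambda>t. frechet_derivative f (at (z + t *\<^sub>R w)) w) has_real_derivative w \<bullet> hessian_map f z w) (at 0)"
    using has_real_derivative_along_line[of "\<lambda>z. frechet_derivative f (at z) w" z 0 w] C1_partial[of w]
    by (simp add: inner_hessian_map)
  show "w \<bullet> gradient f z = 0" "0 \<le> w \<bullet> hessian_map f z w"
    using second_derivative_test[OF p q assms(1)] assms(2)
    by (simp_all add: frechet_derivative_eq_inner_gradient)
qed

lemma local_maximum_along:
  assumes "0 < d" and "\<And>t. \<bar>t\<bar> < d \<Longrightarrow> f (z + t *\<^sub>R w) \<le> f z"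
  shows "w \<bullet> gradient f z = 0" and "w \<bullet> hessian_map f z w \<le> 0"
proof -
  have p: "((\<lambda>t. - f (z + t *\<^sub>R w)) has_real_derivative - frechet_derivative f (at (z + t *\<^sub>R w)) w) (at t)" for t
    by (intro DERIV_minus has_real_derivative_along_line differentiable_f)
  have q: "((\<lambda>t. - frechet_derivative f (at (z + t *\<^sub>R w)) w) has_real_derivative - (w \<bullet> hessian_map f z w)) (at 0)"
    using has_real_derivative_along_line[of "\<lambda>z. frechet_derivative f (at z) w" z 0 w] C1_partial[of w]
    by (intro DERIV_minus) (simp add: inner_hessian_map)
  show "w \<bullet> gradient f z = 0" "w \<bullet> hessian_map f z w \<le> 0"
    using second_derivative_test[OF p q assms(1)] assms(2)
    by (simp_all add: frechet_derivative_eq_inner_gradient)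
qed

end

section \<open>Saddle points and the saddle field\<close>

locale C2_saddle_function = C2_function f
  for f :: "'a::euclidean_space \<times> 'b::euclidean_space \<Rightarrow> real"
begin

text \<open>Along directions \<open>(x, 0)\<close> the function has a local minimum at
  \<open>z\<close>, along \<open>(0, y)\<close> a local maximum, so the one-dimensional tests
  apply.\<close>

lemma saddle_point_conditions:
  assumes "saddle_point f z"
  shows "gradient f z = 0"
    and "0 \<le> (x, 0) \<bullet> hessian_map f z (x, 0)"
    and "(0, y) \<bullet> hessian_map f z (0, y) \<le> 0"
proof -
  obtain U where U: "open U" "z \<in> U"
    and sad: "\<And>x y. (x, y) \<in> U \<Longrightarrow> f (fst z, y) \<le> f z \<and> f z \<le> f (x, snd z)"
    using assms unfolding saddle_point_def by fast
  have line: "\<exists>d>0. \<forall>t. \<bar>t\<bar> < d \<longrightarrow> z + t *\<^sub>R w \<in> U" for w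
  proof -
    have "((\<lambda>t. z + t *\<^sub>R w) \<longlongrightarrow> z + 0 *\<^sub>R w) (at 0)"
      by (intro tendsto_intros)
    then have "\<forall>\<^sub>F t in at 0. z + t *\<^sub>R w \<in> U"
      using U by (auto dest: topological_tendstoD)
    then obtain d where "0 < d" "\<And>t. t \<noteq> 0 \<Longrightarrow> \<bar>t\<bar> < d \<Longrightarrow> z + t *\<^sub>R w \<in> U"
      unfolding eventually_at by (auto simp: dist_real_def)
    then show ?thesis
      using U(2) by (metis add.right_neutral scaleR_zero_left)
  qed
  have min: "(x, 0) \<bullet> gradient f z = 0 \<and> 0 \<le> (x, 0) \<bullet> hessian_map f z (x, 0)" for x
  proof -
    obtain d where d: "0 < d" "\<And>t. \<bar>t\<bar> < d \<Longrightarrow> z + t *\<^sub>R (x, 0) \<in> U"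
      using line by blast
    have eq: "z + t *\<^sub>R (x, 0) = (fst z + t *\<^sub>R x, snd z)" for t
      by (simp add: prod_eq_iff)
    have "f z \<le> f (z + t *\<^sub>R (x, 0))" if "\<bar>t\<bar> < d" for t
      using d(2)[OF that] sad unfolding eq by blast
    then show ?thesis using local_minimum_along[OF d(1)] by blast
  qed
  have max: "(0, y) \<bullet> gradient f z = 0 \<and> (0, y) \<bullet> hessian_map f z (0, y) \<le> 0" for y
  proof -
    obtain d where d: "0 < d" "\<And>t. \<bar>t\<bar> < d \<Longrightarrow> z + t *\<^sub>R (0, y) \<in> U"
      using line by blast
    have eq: "z + t *\<^sub>R (0, y) = (fst z, snd z + t *\<^sub>R y)" for t
      by (simp add: prod_eq_iff)
    have "f (z + t *\<^sub>R (0, y)) \<le> f z" if "\<bar>t\<bar> < d" for t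
      using d(2)[OF that] sad unfolding eq by blast
    then show ?thesis using local_maximum_along[OF d(1)] by blast
  qed
  show "0 \<le> (x, 0) \<bullet> hessian_map f z (x, 0)" "(0, y) \<bullet> hessian_map f z (0, y) \<le> 0"
    using min max by blast+
  \<comment> \<open>Testing with the gradient's own two blocks makes the norm of each block
    0.\<close>
  show "gradient f z = 0"
    using min[of "fst (gradient f z)"] max[of "snd (gradient f z)"]
    by (simp add: inner_prod_def prod_eq_iff)
qed

text \<open>Chain rule along the embeddings of the two factors: the partial gradients are the blocks
  of the full gradient. The field thus differs from the gradient by an isometry, which preserves its
  Lipschitz constant.\<close>

lemma saddle_field_eq: "saddle_field f z = apsnd uminus (gradient f z)"
proof -
  have "GDERIV (\<lambda>x. f (x, snd z)) (fst z) :> fst (gradient f z)"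
  proof -
    have "((\<lambda>x. f (x, snd z)) has_derivative (\<lambda>h. (h, 0) \<bullet> gradient f z)) (at (fst z))"
      using gderiv_gradient(1)[OF differentiable_f, of z, unfolded gderiv_def]
      by (intro has_derivative_compose[of "\<lambda>x. (x, snd z)" _ _ _ f])
        (auto intro!: derivative_eq_intros)
    then show ?thesis by (simp add: gderiv_def inner_prod_def)
  qed
  moreover have "GDERIV (\<lambda>y. f (fst z, y)) (snd z) :> snd (gradient f z)"
  proof -
    have "((\<lambda>y. f (fst z, y)) has_derivative (\<lambda>h. (0, h) \<bullet> gradient f z)) (at (snd z))"
      using gderiv_gradient(1)[OF differentiable_f, of z, unfolded gderiv_def]
      by (intro has_derivative_compose[of "\<lambda>y. (fst z, y)" _ _ _ f])
        (auto intro!: derivative_eq_intros)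
    then show ?thesis by (simp add: gderiv_def inner_prod_def)
  qed
  ultimately show ?thesis
    by (simp add: saddle_field_def gradient_eqI prod_eq_iff)
qed

lemma saddle_field_sum:
  "saddle_field f z = (\<Sum>b\<in>Basis. frechet_derivative f (at z) b *\<^sub>R apsnd uminus b)"
proof -
  have "saddle_field f z = apsnd uminus (\<Sum>b\<in>Basis. frechet_derivative f (at z) b *\<^sub>R b)"
    by (simp only: saddle_field_eq gderiv_gradient(2)[OF differentiable_f])
  also have "\<dots> = (\<Sum>b\<in>Basis. apsnd uminus (frechet_derivative f (at z) b *\<^sub>R b))"
    by (simp add: prod_eq_iff fst_sum snd_sum sum_negf)
  also have "\<dots> = (\<Sum>b\<in>Basis. frechet_derivative f (at z) b *\<^sub>R apsnd uminus b)"
    by (intro sum.cong) (auto simp: prod_eq_iff)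
  finally show ?thesis .
qed

lemma C1_saddle_field: "C_k 1 (saddle_field f)"
  unfolding saddle_field_sum[abs_def] by (rule C_1_sum_scaleR(1)[OF C1_partial])

lemma jacobian_saddle_field_sum:
  "jacobian_map (saddle_field f) z v
    = (\<Sum>b\<in>Basis. frechet_derivative (\<lambda>z. frechet_derivative f (at z) b) (at z) v *\<^sub>R apsnd uminus b)"
  unfolding jacobian_map_def saddle_field_sum[abs_def] by (rule C_1_sum_scaleR(2)[OF C1_partial])

lemma jacobian_saddle_field: "jacobian_map (saddle_field f) z v = apsnd uminus (hessian_map f z v)"
proof -
  have "(saddle_field f has_derivative (\<lambda>v. apsnd uminus (hessian_map f z v))) (at z)"
  proof -
    have "((\<lambda>z. (fst (gradient f z), - snd (gradient f z))) has_derivative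
        (\<lambda>v. (fst (hessian_map f z v), - snd (hessian_map f z v)))) (at z)"
      by (intro has_derivative_Pair has_derivative_minus has_derivative_fst has_derivative_snd
          has_derivative_gradient)
    then show ?thesis
      by (simp add: saddle_field_eq[abs_def] apsnd_def map_prod_def case_prod_beta)
  qed
  then show ?thesis
    unfolding jacobian_map_def using frechet_derivative_at by metis
qed

lemma lipschitz_saddle_field:
  assumes "L-lipschitz_on UNIV (gradient f)"
  shows "L-lipschitz_on UNIV (saddle_field f)"
proof (rule lipschitz_onI)
  fix x y
  have "dist (saddle_field f x) (saddle_field f y) = dist (gradient f x) (gradient f y)"
    by (simp add: saddle_field_eq dist_prod_def dist_minus)
  then show "dist (saddle_field f x) (saddle_field f y) \<le> L * dist x y"
    using lipschitz_onD[OF assms] by simp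
qed (rule lipschitz_on_nonneg[OF assms])

lemma jacobian_saddle_field_monotone:
  assumes "saddle_point f z"
  shows "0 \<le> jacobian_map (saddle_field f) z w \<bullet> w"
proof -
  let ?H = "hessian_map f z" let ?p = "(fst w, 0)" let ?q = "(0, snd w)"
  have lin: "linear ?H"
    using has_derivative_gradient has_derivative_linear by blast
  have "w = ?p + ?q" by (simp add: prod_eq_iff)
  then have Hw: "?H w = ?H ?p + ?H ?q"
    using linear_add[OF lin] by metis
  have "jacobian_map (saddle_field f) z w \<bullet> w = ?p \<bullet> ?H w - ?q \<bullet> ?H w"
    by (simp add: jacobian_saddle_field inner_prod_def inner_commute)
  \<comment> \<open>The mixed terms cancel by symmetry of the Hessian; the sign flip in the second
    block makes them opposite.\<close>
  also have "\<dots> = ?p \<bullet> ?H ?p - ?q \<bullet> ?H ?q"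
    unfolding Hw using hessian_map_symmetric[of ?p z ?q] by (simp only: inner_add_right)
  finally show ?thesis
    using saddle_point_conditions[OF assms] by smt
qed

lemma jacobian_saddle_field_inj:
  assumes "bij (hessian_map f z)" shows "inj (jacobian_map (saddle_field f) z)"
proof (rule injI)
  fix x y assume "jacobian_map (saddle_field f) z x = jacobian_map (saddle_field f) z y"
  then have "hessian_map f z x = hessian_map f z y"
    by (simp add: jacobian_saddle_field prod_eq_iff)
  then show "x = y" using assms by (metis bij_is_inj injD)
qed

lemma saddle_field_zero: "saddle_point f z \<Longrightarrow> saddle_field f z = 0"
  by (simp add: saddle_field_eq saddle_point_conditions(1) prod_eq_iff)

lemma C1_jacobian_saddle_field:
  assumes "C_k 3 f" shows "C_k 1 (\<lambda>z. jacobian_map (saddle_field f) z e)"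
  unfolding jacobian_saddle_field_sum
  by (rule C_1_sum_scaleR(1)[OF C1_second_partial[OF assms]])

end

theorem theorem4p16:
  fixes f :: "(real ^ 'n) \<times> (real ^ 'm) \<Rightarrow> real" and L :: real
  assumes C2: "C_k 2 f"
    and L_pos: "L > 0"
    and lip: "L-lipschitz_on UNIV (gradient f)"
    and nondeg: "\<And>z. saddle_point f z \<Longrightarrow> bij (hessian_map f z)"
  shows
    "(\<exists>phi_min. \<forall>\<phi>. \<phi> > phi_min \<and> \<phi> > L \<longrightarrow>
        {z. saddle_point f z} \<subseteq>
        {z. exponentially_stable_equilibrium (rdn_ode_O1 (saddle_field f) \<phi>) z})
     \<and>
     (\<forall>\<phi>>L. C_k 3 f \<longrightarrow>
        (\<exists>s_max>0. \<forall>s\<in>{0<..<s_max}.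
           {z. saddle_point f z} \<subseteq>
           {z. exponentially_stable_equilibrium (rdn_ode_Os (saddle_field f) \<phi> s) z}))"
proof -
  interpret C2_saddle_function f
    using C2 by unfold_locales
  have newton: "regularised_newton (saddle_field f) L \<phi>" if "\<phi> > L" for \<phi>
    by (rule regularised_newton.intro[OF C1_saddle_field lipschitz_saddle_field[OF lip] that])
  note saddle = saddle_field_zero jacobian_saddle_field_monotone jacobian_saddle_field_inj[OF nondeg]
  have "exponentially_stable_equilibrium (rdn_ode_O1 (saddle_field f) \<phi>) z"
    if "\<phi> > L" "saddle_point f z" for \<phi> z
    using regularised_newton.exponentially_stable_O1[OF newton[OF that(1)]] saddle that(2) by blast
  moreover have "exponentially_stable_equilibrium (rdn_ode_Os (saddle_field f) \<phi> s) z"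
    if "\<phi> > L" "C_k 3 f" "s \<in> {0<..<2}" "saddle_point f z" for \<phi> s z
    using regularised_newton.exponentially_stable_Os[OF newton[OF that(1)] C1_jacobian_saddle_field[OF that(2)]]
      saddle that by simp
  ultimately show ?thesis
    \<comment> \<open>The witnesses are \<open>L\<close> for \<open>phi_min\<close> and 2 for
      \<open>s_max\<close>; neither depends on the saddle point.\<close>
    by (intro conjI exI[of _ L] allI impI exI[of _ "2::real"]) auto
qed

end
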